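(* Suppose $G$ is a polycyclic group that is not virtually nilpotent. Then $G$ has a Schreier growth gap $\exp(n)$.
   Context: Let $G$ be a finitely generated group, $S$ a finite symmetric generating set, and $|\cdot|_S$ the word length. A $G$-set is a non-empty set with a $G$-action (not necessarily transitive); it is faithful if only the identity of $G$ acts trivially. The growth of the action of $G$ on a $G$-set $X$ is $\mathrm{vol}_{G,X}(n)=\max_{x\in X}|\{gx : g\in G,\ |g|_S\le n\}|$. For functions $f,g$ from $\mathbb{N}$ to the non-negative reals, $f(n)\preccurlyeq g(n)$ (equivalently $g(n)\succcurlyeq f(n)$) means that there is a constant $C>0$ such that $f(n)\le C g(Cn)$ for all sufficiently large $n$; $f\simeq g$ means $f\preccurlyeq g$ and $g\preccurlyeq f$. Up to $\simeq$, $\mathrm{vol}_{G,X}$ does not depend on $S$. The group $G$ has a Schreier growth gap $f(n)$ if every faithful $G$-set $X$ satisfies $\mathrm{vol}_{G,X}(n)\succcurlyeq f(n)$. *)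

theory Defs
  imports Complex_Main "HOL-Algebra.Group_Action" "HOL-Algebra.Elementary_Groups"
    "HOL-Algebra.Solvable_Groups"
begin

section \<open>Polycyclic and virtually nilpotent groups\<close>

text \<open>The series is built upwards from the trivial subgroup, in the style of
  \<^const>\<open>solvable_seq\<close>; the factors are cyclic (finite or infinite).\<close>

inductive polycyclic_seq :: "('a, 'm) monoid_scheme \<Rightarrow> 'a set \<Rightarrow> bool"
  for G where
    unity: "polycyclic_seq G {\<one>\<^bsub>G\<^esub>}"
  | extension: "\<lbrakk> polycyclic_seq G K; K \<lhd> (G\<lparr>carrier := H\<rparr>); subgroup H G;
                  cyclic_group ((G\<lparr>carrier := H\<rparr>) Mod K) \<rbrakk> \<Longrightarrow> polycyclic_seq G H"

definition polycyclic_group :: "('a, 'm) monoid_scheme \<Rightarrow> bool" where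
  "polycyclic_group G \<longleftrightarrow> group G \<and> polycyclic_seq G (carrier G)"

primrec lower_central :: "('a, 'm) monoid_scheme \<Rightarrow> nat \<Rightarrow> 'a set" where
  "lower_central G 0 = carrier G"
| "lower_central G (Suc n) = generate G
     {x \<otimes>\<^bsub>G\<^esub> y \<otimes>\<^bsub>G\<^esub> inv\<^bsub>G\<^esub> x \<otimes>\<^bsub>G\<^esub> inv\<^bsub>G\<^esub> y | x y. x \<in> lower_central G n \<and> y \<in> carrier G}"

definition nilpotent_group :: "('a, 'm) monoid_scheme \<Rightarrow> bool" where
  "nilpotent_group G \<longleftrightarrow> group G \<and> (\<exists>n. lower_central G n = {\<one>\<^bsub>G\<^esub>})"

definition virtually_nilpotent :: "('a, 'm) monoid_scheme \<Rightarrow> bool" where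
  "virtually_nilpotent G \<longleftrightarrow>
     (\<exists>H. subgroup H G \<and> finite (rcosets\<^bsub>G\<^esub> H) \<and> nilpotent_group (G\<lparr>carrier := H\<rparr>))"


section \<open>Word length and growth of actions\<close>

definition symmetric_generating_set :: "('a, 'm) monoid_scheme \<Rightarrow> 'a set \<Rightarrow> bool" where
  "symmetric_generating_set G S \<longleftrightarrow>
     S \<subseteq> carrier G \<and> (\<forall>s\<in>S. inv\<^bsub>G\<^esub> s \<in> S) \<and> generate G S = carrier G"

text \<open>Only meaningful for \<open>g\<close> in the subgroup generated by the symmetric set \<open>S\<close>; otherwise
  the set of lengths is empty and \<^term>\<open>Least\<close> is unspecified.\<close>

definition word_length :: "('a, 'm) monoid_scheme \<Rightarrow> 'a set \<Rightarrow> 'a \<Rightarrow> nat" where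
  "word_length G S g =
     (LEAST n. \<exists>ws. set ws \<subseteq> S \<and> length ws = n \<and> foldr (\<lambda>s h. s \<otimes>\<^bsub>G\<^esub> h) ws \<one>\<^bsub>G\<^esub> = g)"

text \<open>For a finite generating set \<open>S\<close> the cardinalities below are bounded by that of the ball of
  radius \<open>n\<close> in \<open>G\<close>, so, for non-empty \<open>X\<close>, \<^const>\<open>Max\<close> is taken over a finite non-empty set.\<close>

definition action_growth ::
  "('a, 'm) monoid_scheme \<Rightarrow> 'a set \<Rightarrow> 'x set \<Rightarrow> ('a \<Rightarrow> 'x \<Rightarrow> 'x) \<Rightarrow> nat \<Rightarrow> nat" where
  "action_growth G S X \<phi> n =
     Max ((\<lambda>x. card {\<phi> g x | g. g \<in> carrier G \<and> word_length G S g \<le> n}) ` X)"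


section \<open>Schreier growth gaps\<close>

text \<open>The constant is a positive integer, so that \<open>C * n\<close> is again an admissible argument. For
  non-decreasing \<open>g\<close> this agrees with allowing real constants.\<close>

definition growth_dominated :: "(nat \<Rightarrow> real) \<Rightarrow> (nat \<Rightarrow> real) \<Rightarrow> bool"  (infix \<open>\<preccurlyeq>\<close> 50) where
  "f \<preccurlyeq> g \<longleftrightarrow> (\<exists>C::nat. C > 0 \<and> (\<forall>\<^sub>F n in sequentially. f n \<le> real C * g (C * n)))"

text \<open>The notion concerns finitely generated groups (such as polycyclic groups). As growth does not
  depend on the finite symmetric generating set up to equivalence, the bound is required for
  all of them. HOL cannot quantify over types inside a formula, so the type \<open>'x\<close> of the
  points of the \<open>G\<close>-sets is a parameter; a theorem with \<open>'x\<close> free covers \<open>G\<close>-sets of every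
  type. Faithfulness is injectivity of the homomorphism \<open>\<phi>\<close> into the symmetric group
  of \<open>X\<close>, that is, triviality of its kernel.\<close>

definition has_schreier_growth_gap ::
  "'x itself \<Rightarrow> ('a, 'm) monoid_scheme \<Rightarrow> (nat \<Rightarrow> real) \<Rightarrow> bool" where
  "has_schreier_growth_gap (_ :: 'x itself) G f \<longleftrightarrow>
     (\<forall>S. finite S \<and> symmetric_generating_set G S \<longrightarrow>
       (\<forall>(X :: 'x set) \<phi>. X \<noteq> {} \<and> faithful_action G X \<phi> \<longrightarrow>
          f \<preccurlyeq> (\<lambda>n. real (action_growth G S X \<phi> n))))"

end

theory Submission
  imports Defs "HOL-Algebra.Zassenhaus" "HOL-Computational_Algebra.Fundamental_Theorem_Algebra"
begin

text \<open>Let the stabilisers of a faithful action form a family \<open>\<H>\<close> of subgroups, closed under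
  conjugation and with trivial intersection, and suppose that the action does not have
  exponential growth; one shows that \<open>G\<close> is virtually nilpotent. More generally, if \<open>\<H>\<close> has
  intersection \<open>N\<close>, then \<open>G\<close> is virtually nilpotent modulo \<open>N\<close>, by Noetherian induction on \<open>N\<close>.

  Consider a normal abelian section \<open>M/N\<close> and \<open>h \<in> G\<close>. If \<open>h\<close> acts on it with an eigenvalue off
  the unit circle, then, for a suitable power of \<open>h\<close>, products of nonzero polynomials in \<open>h\<close> with
  coefficients in \<open>{-1, 0, 1}\<close> do not annihilate \<open>M/N\<close>. So for every \<open>n\<close> the product of all those
  of degree less than \<open>n\<close> is nonzero modulo some stabiliser, and this forces exponential growth
  of its orbit. Otherwise all eigenvalues are roots of unity by Kronecker's theorem, and \<open>h\<close>
  has a nontrivial periodic point in every invariant subsection. Climbing along the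
  polycyclic series yields a nontrivial normal \<open>C/N \<le> M/N\<close> centralised by a subgroup \<open>Z\<close> of
  finite index. Replacing every \<open>H \<in> \<H>\<close> by \<open>HC\<close> (which amounts to the action on \<open>X/C\<close>) enlarges
  \<open>N\<close> to some \<open>K\<close> without increasing the growth, and \<open>(K \<inter> Z)/N\<close> is again abelian, so that
  the argument above descends from \<open>K\<close> to \<open>N\<close> through sections with centralisers of finite
  index.\<close>

section \<open>Integer polynomials and their complex roots\<close>

text \<open>Stabilisers are in general neither normal nor invariant under \<open>h\<close>, so
  \<open>h\<close> does not act on \<open>M\<close> modulo a stabiliser \<open>H\<close>; it acts
  only modulo \<open>N\<close>. What survives is that, for a fixed polynomial \<open>f\<close>, the
  elements of \<open>M\<close> that \<open>f(h)\<close> sends into \<open>H\<close> form a subgroup,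
  because \<open>H\<close> contains \<open>N\<close>. Nonvanishing modulo \<open>N\<close> alone
  could require another stabiliser for every \<open>f\<close>, whereas growth must show at a single
  point; the product of all polynomials forces one stabiliser to detect each of them. Different
  \<open>f\<close> may still be detected by different generators of \<open>M\<close>. This costs a
  root of the orbit size, of order the number of generators, which leaves exponential growth intact.

  An intermediate \<open>D\<close> need not be an intersection of members of \<open>\<H>\<close>, so
  growth can be counted only modulo \<open>N\<close>. Hence every descent has to stay inside a
  section that is abelian modulo \<open>N\<close>, which is why \<open>K\<close> is first cut down
  to \<open>K \<inter> Z\<close>. Kronecker's theorem supplies one periodic element and not
  triviality of a power of \<open>h\<close> on the section; therefore centralised pieces are split
  off one at a time.\<close>

abbreviation of_int_poly :: "int poly \<Rightarrow> 'a::ring_char_0 poly" where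
  "of_int_poly \<equiv> map_poly of_int"

lemma of_int_poly_add: "of_int_poly (p + q) = of_int_poly p + of_int_poly q"
  by (intro poly_eqI) (simp add: coeff_map_poly)

lemma of_int_poly_diff: "of_int_poly (p - q) = of_int_poly p - of_int_poly q"
  by (intro poly_eqI) (simp add: coeff_map_poly)

lemma of_int_poly_smult: "of_int_poly (smult c p) = smult (of_int c) (of_int_poly p)"
  by (intro poly_eqI) (simp add: coeff_map_poly)

lemma of_int_poly_mult: "of_int_poly (p * q) = of_int_poly p * (of_int_poly q :: 'a::{ring_char_0,comm_ring_1} poly)"
  by (intro poly_eqI) (simp add: coeff_map_poly coeff_mult)

lemma of_int_poly_monom: "of_int_poly (monom c n) = monom (of_int c) n"
  by (intro poly_eqI) (simp add: coeff_map_poly)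

lemma of_int_poly_prod:
  "of_int_poly (\<Prod>x\<in>A. f x) = (\<Prod>x\<in>A. of_int_poly (f x) :: 'a::{ring_char_0,comm_ring_1} poly)"
  by (induction A rule: infinite_finite_induct) (auto simp: of_int_poly_mult)

lemma degree_of_int_poly [simp]: "degree (of_int_poly p :: 'a::ring_char_0 poly) = degree p"
  by (rule degree_map_poly) auto

lemma of_int_poly_eq_0_iff [simp]: "(of_int_poly p :: 'a::ring_char_0 poly) = 0 \<longleftrightarrow> p = 0"
  by (simp add: poly_eq_iff coeff_map_poly)

lemma pderiv_of_int_poly: "pderiv (of_int_poly p :: 'a::{ring_char_0,idom} poly) = of_int_poly (pderiv p)"
  by (intro poly_eqI) (simp add: coeff_map_poly coeff_pderiv)

text \<open>The \<open>L a\<close> are the Lagrange basis polynomials of \<open>A\<close>, so every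
  coefficient of \<open>r\<close> is a fixed linear combination of the values of \<open>r\<close> on
  \<open>A\<close>.\<close>

lemma coeff_bound_of_values:
  fixes A :: "complex set"
  assumes "finite A"
  shows "\<exists>B. \<forall>r. degree r < card A \<longrightarrow> (\<forall>a\<in>A. norm (poly r a) \<le> M) \<longrightarrow> (\<forall>j. norm (coeff r j) \<le> B)"
proof -
  define L where "L a = (\<Prod>b\<in>A-{a}. [:- b / (a - b), 1 / (a - b):])" for a
  have degL: "degree (L a) < card A" if "a \<in> A" for a
  proof -
    have "degree (L a) \<le> sum (degree \<circ> (\<lambda>b. [:- b / (a - b), 1 / (a - b):])) (A - {a})"
      unfolding L_def by (rule degree_prod_sum_le) (use assms in auto)
    also have "\<dots> \<le> (\<Sum>b\<in>A-{a}. 1)" by (rule sum_mono) auto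
    also have "\<dots> < card A" using that assms by (auto simp: card_gt_0_iff intro!: diff_less)
    finally show ?thesis .
  qed
  have L1: "poly (L a) a = 1" for a
    unfolding L_def poly_prod
    by (rule prod.neutral) (auto simp: minus_divide_left add_divide_distrib[symmetric] simp del: minus_divide_left[symmetric])
  have L0: "poly (L a) b = 0" if "b \<in> A" "b \<noteq> a" for a b
    unfolding L_def poly_prod by (rule prod_zero) (use assms that in \<open>auto simp: field_simps\<close>)
  define D where "D = (\<Sum>a\<in>A. degree (L a))"
  define B where "B = (\<Sum>a\<in>A. \<bar>M\<bar> * (\<Sum>j\<le>D. norm (coeff (L a) j)))"
  have "norm (coeff r j) \<le> B" if r: "degree r < card A" "\<forall>a\<in>A. norm (poly r a) \<le> M" for r j
  proof -
    have "r = (\<Sum>a\<in>A. smult (poly r a) (L a))" (is "r = ?R")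
    proof (rule poly_eqI_degree[of A])
      fix b assume "b \<in> A"
      have "poly ?R b = (\<Sum>a\<in>A. if a = b then poly r b else 0)"
        unfolding poly_sum by (rule sum.cong) (use L0[OF \<open>b \<in> A\<close>] L1 in auto)
      then show "poly r b = poly ?R b" using assms \<open>b \<in> A\<close> by simp
    next
      show "degree ?R < card A"
        by (rule degree_sum_less) (use degL r in \<open>auto intro: le_less_trans[OF degree_smult_le]\<close>)
    qed (use r in auto)
    then have "coeff r j = (\<Sum>a\<in>A. poly r a * coeff (L a) j)"
      by (metis (no_types, lifting) coeff_smult coeff_sum sum.cong)
    also have "norm \<dots> \<le> B"
      unfolding B_def
    proof (rule order_trans[OF norm_sum], rule sum_mono)
      fix a assume a: "a \<in> A"
      have "norm (coeff (L a) j) \<le> (\<Sum>j\<le>D. norm (coeff (L a) j))"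
      proof (cases "j \<le> D")
        case True
        then show ?thesis by (intro member_le_sum) auto
      next
        case False
        have "degree (L a) \<le> D" unfolding D_def using assms a by (intro member_le_sum) auto
        with False have "coeff (L a) j = 0" by (intro coeff_eq_0) auto
        then show ?thesis by (simp add: sum_nonneg)
      qed
      moreover have "norm (poly r a) \<le> \<bar>M\<bar>" using r a by force
      ultimately show "norm (poly r a * coeff (L a) j) \<le> \<bar>M\<bar> * (\<Sum>j\<le>D. norm (coeff (L a) j))"
        unfolding norm_mult by (intro mult_mono) auto
    qed
    finally show ?thesis .
  qed
  then show ?thesis by blast
qed

lemma finite_bounded_int_polys:
  "finite {r :: int poly. degree r \<le> n \<and> (\<forall>j. \<bar>coeff r j\<bar> \<le> B)}"
proof (rule finite_subset)
  let ?S = "{xs :: int list. set xs \<subseteq> {-B..B} \<and> length xs \<le> Suc n}"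
  show "finite (Poly ` ?S)" by (intro finite_imageI finite_lists_length_le) auto
  show "{r :: int poly. degree r \<le> n \<and> (\<forall>j. \<bar>coeff r j\<bar> \<le> B)} \<subseteq> Poly ` ?S"
  proof clarsimp
    fix r :: "int poly" assume r: "degree r \<le> n" "\<forall>j. \<bar>coeff r j\<bar> \<le> B"
    have "length (coeffs r) \<le> Suc n" using r by (cases "r = 0") (auto simp: length_coeffs_degree)
    moreover have "set (coeffs r) \<subseteq> {-B..B}"
    proof
      fix x assume "x \<in> set (coeffs r)"
      then obtain j where "x = coeff r j" using range_coeff[of r] by blast
      then have "\<bar>x\<bar> \<le> B" using r by simp
      then show "x \<in> {-B..B}" by auto
    qed
    ultimately show "r \<in> Poly ` ?S" by (intro image_eqI[of _ _ "coeffs r"]) auto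
  qed
qed

text \<open>The leading term has modulus \<open>x ^ d\<close>, and the remaining terms add up to at
  most a geometric sum, which is smaller than \<open>x ^ d\<close> because
  \<open>x \<ge> 2\<close>.\<close>

lemma poly_unit_coeffs_neq_0:
  fixes f :: "int poly" and z :: complex
  assumes "f \<noteq> 0" "\<forall>i. coeff f i \<in> {-1, 0, 1}" "norm z \<ge> 2"
  shows "poly (of_int_poly f) z \<noteq> 0"
proof
  assume "poly (of_int_poly f) z = 0"
  define d where "d = degree f"
  define x where "x = norm z"
  have x: "x \<ge> 2" using assms by (simp add: x_def)
  have dd: "degree (of_int_poly f :: complex poly) = d" by (simp add: d_def)
  have "(\<Sum>i<d. of_int (coeff f i) * z ^ i) + of_int (coeff f d) * z ^ d = 0"
    using \<open>poly (of_int_poly f) z = 0\<close> by (simp add: poly_altdef dd coeff_map_poly lessThan_Suc_atMost[symmetric] d_def[symmetric])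
  then have "norm (of_int (coeff f d) * z ^ d) = norm (\<Sum>i<d. of_int (coeff f i) * z ^ i)"
    by (metis add.commute add_eq_0_iff norm_minus_cancel)
  also have "\<dots> \<le> (\<Sum>i<d. norm (of_int (coeff f i) * z ^ i))" by (rule norm_sum)
  also have "\<dots> \<le> (\<Sum>i<d. x ^ i)"
  proof (rule sum_mono)
    fix i
    have "\<bar>coeff f i\<bar> \<le> 1" using assms(2)[rule_format, of i] by auto
    then have "\<bar>real_of_int (coeff f i)\<bar> \<le> 1" by linarith
    then show "norm (of_int (coeff f i) * z ^ i) \<le> x ^ i"
      unfolding norm_mult norm_power x_def[symmetric] norm_of_int
      using x by (intro mult_left_le_one_le) auto
  qed
  also have "\<dots> < x ^ d"
  proof (induction d)
    case (Suc d)
    have "(\<Sum>i<Suc d. x ^ i) < 2 * x ^ d" using Suc by simp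
    also have "\<dots> \<le> x ^ Suc d" using x by (simp add: mult_right_mono)
    finally show ?case .
  qed simp
  finally have "norm (of_int (coeff f d) :: complex) * x ^ d < x ^ d" by (simp add: norm_mult norm_power x_def)
  moreover have "coeff f d = 1 \<or> coeff f d = -1"
    using assms(1) assms(2)[rule_format, of d] by (auto simp: d_def)
  ultimately show False by auto
qed

text \<open>Kronecker's argument: \<open>r k\<close> represents \<open>N x^k\<close> modulo \<open>q\<close>.\<close>

lemma bounded_remainders_repeat:
  fixes q :: "int poly" and r :: "nat \<Rightarrow> int poly"
  assumes sqf: "rsquarefree (of_int_poly q :: complex poly)"
    and roots: "\<And>z::complex. poly (of_int_poly q) z = 0 \<Longrightarrow> norm z \<le> 1"
    and deg: "\<And>k. degree (r k) < degree q"
    and val: "\<And>k z::complex. poly (of_int_poly q) z = 0 \<Longrightarrow> poly (of_int_poly (r k)) z = of_int N * z ^ k"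
  shows "\<exists>k l. k < l \<and> r k = r l"
proof -
  define A where "A = {z::complex. poly (of_int_poly q) z = 0}"
  have q0: "of_int_poly q \<noteq> (0 :: complex poly)" using sqf by (simp add: rsquarefree_def)
  have finA: "finite A" unfolding A_def by (rule poly_roots_finite[OF q0])
  \<comment> \<open>Squarefreeness gives as many distinct roots as the degree, so the values at the
    roots determine all coefficients of \<open>r k\<close>.\<close>
  have cardA: "card A = degree q"
  proof -
    have "of_int_poly q = smult (lead_coeff (of_int_poly q)) (\<Prod>z\<in>A. [:-z, 1:])"
      unfolding A_def by (rule complex_poly_decompose_rsquarefree[OF sqf, symmetric])
    then have "degree (of_int_poly q :: complex poly) = degree (\<Prod>z\<in>A. [:-z, 1:])"
      by (metis degree_smult_eq leading_coeff_0_iff q0)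
    then show ?thesis by (simp add: degree_prod_sum_eq)
  qed
  obtain B where B: "\<And>r j. degree r < card A \<Longrightarrow> \<forall>a\<in>A. norm (poly r a) \<le> \<bar>of_int N\<bar> \<Longrightarrow> norm (coeff r j) \<le> B"
    using coeff_bound_of_values[OF finA] by metis
  have "r k \<in> {p. degree p \<le> degree q \<and> (\<forall>j. \<bar>coeff p j\<bar> \<le> \<lceil>B\<rceil>)}" for k
  proof clarsimp
    have "norm (coeff (of_int_poly (r k) :: complex poly) j) \<le> B" for j
    proof (rule B)
      show "\<forall>a\<in>A. norm (poly (of_int_poly (r k)) a) \<le> \<bar>of_int N\<bar>"
        unfolding A_def by (auto simp: val norm_mult norm_power roots power_le_one mult_left_le)
    qed (use deg cardA in simp)
    then have "\<bar>coeff (r k) j\<bar> \<le> \<lceil>B\<rceil>" for j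
      by (metis coeff_map_poly[of of_int, OF of_int_0] ceiling_mono ceiling_of_int norm_of_int of_int_abs)
    then show "degree (r k) \<le> degree q \<and> (\<forall>j. \<bar>coeff (r k) j\<bar> \<le> \<lceil>B\<rceil>)"
      using deg[of k] by (simp add: less_imp_le)
  qed
  then have "finite (range r)" by (blast intro: finite_subset[OF _ finite_bounded_int_polys])
  then have "\<not> inj r" using finite_imageD infinite_UNIV_nat by blast
  then show ?thesis unfolding inj_def by (metis nat_neq_iff)
qed

section \<open>Endomorphisms of finitely generated abelian groups\<close>

text \<open>The polynomial \<open>p\<close> applied to \<open>w\<close>, with \<open>x\<close> acting as \<open>\<sigma>\<close>, in Horner form; the order of the
  factors matters when \<open>G\<close> is not abelian.\<close>

definition pact :: "('a, 'm) monoid_scheme \<Rightarrow> ('a \<Rightarrow> 'a) \<Rightarrow> int poly \<Rightarrow> 'a \<Rightarrow> 'a" where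
  "pact G \<sigma> p w = foldr (\<lambda>c y. w [^]\<^bsub>G\<^esub> c \<otimes>\<^bsub>G\<^esub> \<sigma> y) (coeffs p) \<one>\<^bsub>G\<^esub>"

lemma pact_0 [simp]: "pact G \<sigma> 0 w = \<one>\<^bsub>G\<^esub>"
  by (simp add: pact_def)

lemma (in group) pact_pCons:
  assumes "\<sigma> \<one> = \<one>"
  shows "pact G \<sigma> (pCons c p) w = w [^] c \<otimes> \<sigma> (pact G \<sigma> p w)"
proof (cases "c = 0 \<and> p = 0")
  case True
  then show ?thesis using assms by simp
next
  case False
  then have "coeffs (pCons c p) = c # coeffs p" by (auto simp: cCons_def)
  then show ?thesis by (simp add: pact_def)
qed

lemma (in group) pact_closed:
  assumes "\<sigma> \<one> = \<one>" "subgroup M G" "\<sigma> ` M \<subseteq> M" "w \<in> M"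
  shows "pact G \<sigma> p w \<in> M"
proof (induction p)
  case 0
  then show ?case using assms(2) by (simp add: subgroup.one_closed)
next
  case (pCons c p)
  then show ?case using assms
    by (auto simp: pact_pCons intro!: subgroup.m_closed[OF assms(2)] subgroup_int_pow_closed)
qed

text \<open>Horner form is built from powers, products and \<open>\<sigma>\<close>, so a
  homomorphism that intertwines \<open>\<sigma>\<close> with \<open>\<tau>\<close> passes through
  it. This transports evaluations from a non-abelian \<open>G\<close> to an abelian section, where
  the module laws hold.\<close>

lemma (in group) pact_hom_image:
  assumes H: "group H" and \<pi>: "\<pi> \<in> hom (G\<lparr>carrier := M\<rparr>) H" and M: "subgroup M G"
    and \<sigma>: "\<sigma> \<one> = \<one>" "\<sigma> ` M \<subseteq> M" and \<tau>: "\<And>m. m \<in> M \<Longrightarrow> \<pi> (\<sigma> m) = \<tau> (\<pi> m)"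
    and w: "w \<in> M"
  shows "\<pi> (pact G \<sigma> p w) = pact H \<tau> p (\<pi> w)"
proof -
  interpret M: group "G\<lparr>carrier := M\<rparr>" using M by (rule subgroup_imp_group)
  interpret h: group_hom "G\<lparr>carrier := M\<rparr>" H \<pi>
    using H \<pi> by (simp add: group_hom_def group_hom_axioms_def M.is_group)
  have \<tau>1: "\<tau> \<one>\<^bsub>H\<^esub> = \<one>\<^bsub>H\<^esub>"
    using \<tau>[of \<one>] \<sigma> subgroup.one_closed[OF M] h.hom_one by simp
  show ?thesis
  proof (induction p)
    case 0
    show ?case using h.hom_one by simp
  next
    case (pCons c p)
    have *: "pact G \<sigma> p w \<in> M" using pact_closed \<sigma> M w by blast
    have wc: "w [^] c \<in> M" using subgroup_int_pow_closed[OF M w] .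
    have "\<pi> (w [^] c) = \<pi> w [^]\<^bsub>H\<^esub> c"
      using h.hom_int_pow[of w c] int_pow_consistent[OF M w] w by simp
    moreover have "\<sigma> (pact G \<sigma> p w) \<in> M" using * \<sigma> by blast
    ultimately show ?case
      using h.hom_mult[of "w [^] c" "\<sigma> (pact G \<sigma> p w)"] wc pCons \<tau>[OF *]
      by (simp add: pact_pCons \<sigma> group.pact_pCons[OF H] \<tau>1)
  qed
qed

section \<open>An abelian group with an endomorphism as a module over the integer
  polynomials\<close>

locale abelian_endo = comm_group A for A (structure) +
  fixes \<sigma> assumes endo: "\<sigma> \<in> hom A A"
begin

lemma endo_closed [simp, intro]: "x \<in> carrier A \<Longrightarrow> \<sigma> x \<in> carrier A"
  using endo by (auto simp: hom_def)

lemma endo_mult: "x \<in> carrier A \<Longrightarrow> y \<in> carrier A \<Longrightarrow> \<sigma> (x \<otimes> y) = \<sigma> x \<otimes> \<sigma> y"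
  using endo by (auto simp: hom_def)

lemma endo_one [simp]: "\<sigma> \<one> = \<one>"
  using endo hom_one is_group by blast

lemma endo_int_pow: "x \<in> carrier A \<Longrightarrow> \<sigma> (x [^] (n::int)) = \<sigma> x [^] n"
  using group_hom.hom_int_pow[of A A \<sigma>] endo is_group by (simp add: group_hom_def group_hom_axioms_def)

lemma pact_carrier [simp, intro]: "w \<in> carrier A \<Longrightarrow> pact A \<sigma> p w \<in> carrier A"
  by (rule pact_closed) (auto simp: subgroup_self)

lemma pact_add: 
  assumes "w \<in> carrier A"
  shows "pact A \<sigma> (p + q) w = pact A \<sigma> p w \<otimes> pact A \<sigma> q w"
proof (induction p arbitrary: q)
  case 0
  then show ?case using assms by simp
next
  case (pCons c p)
  obtain d r where q: "q = pCons d r" by (cases q)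
  show ?case using assms
    by (simp add: q pact_pCons pCons.IH int_pow_mult endo_mult m_ac)
qed

lemma pact_const: "w \<in> carrier A \<Longrightarrow> pact A \<sigma> [:c:] w = w [^] c"
  by (simp add: pact_pCons)

lemma pact_mult_elem:
  assumes "v \<in> carrier A" "w \<in> carrier A"
  shows "pact A \<sigma> p (v \<otimes> w) = pact A \<sigma> p v \<otimes> pact A \<sigma> p w"
  by (induction p) (use assms in \<open>simp_all add: pact_pCons int_pow_distrib endo_mult m_ac\<close>)

lemma pact_one [simp]: "pact A \<sigma> p \<one> = \<one>"
  by (induction p) (simp_all add: pact_pCons)

lemma pact_inv_elem:
  assumes "w \<in> carrier A"
  shows "pact A \<sigma> p (inv w) = inv (pact A \<sigma> p w)"
  using pact_mult_elem[of "inv w" w p] assms by (intro inv_equality[symmetric]) auto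

lemma pact_smult:
  assumes "w \<in> carrier A"
  shows "pact A \<sigma> (smult c p) w = pact A \<sigma> p w [^] c"
  by (induction p) (use assms in \<open>simp_all add: pact_pCons int_pow_distrib int_pow_pow endo_int_pow mult.commute[of c]\<close>)

lemma pact_uminus:
  assumes "w \<in> carrier A"
  shows "pact A \<sigma> (- p) w = inv (pact A \<sigma> p w)"
  using pact_smult[OF assms, of "-1" p] assms by (simp add: int_pow_neg)

lemma pact_diff:
  assumes "w \<in> carrier A"
  shows "pact A \<sigma> (p - q) w = pact A \<sigma> p w \<otimes> inv (pact A \<sigma> q w)"
  using pact_add[OF assms, of p "- q"] by (simp add: pact_uminus assms)

lemma pact_mult:
  assumes "w \<in> carrier A"
  shows "pact A \<sigma> (p * q) w = pact A \<sigma> p (pact A \<sigma> q w)"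
  by (induction p) (use assms in \<open>simp_all add: pact_pCons pact_add pact_smult\<close>)

lemma funpow_carrier [simp, intro]: "w \<in> carrier A \<Longrightarrow> (\<sigma> ^^ k) w \<in> carrier A"
  by (induction k) auto

lemma pact_monom: "w \<in> carrier A \<Longrightarrow> pact A \<sigma> (monom 1 k) w = (\<sigma> ^^ k) w"
  by (induction k) (simp_all add: pact_pCons monom_Suc pact_const monom_0)

lemma endo_funpow: "abelian_endo A (\<sigma> ^^ k)"
proof
  show "\<sigma> ^^ k \<in> hom A A"
  proof (induction k)
    case (Suc k)
    then show ?case by (auto simp: hom_def endo_mult Pi_iff)
  qed (simp add: hom_def)
qed

lemma pact_funpow:
  assumes "w \<in> carrier A"
  shows "pact A (\<sigma> ^^ k) p w = pact A \<sigma> (pcompose p (monom 1 k)) w"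
proof (induction p)
  case (pCons c p)
  have one: "(\<sigma> ^^ k) \<one> = \<one>" by (rule abelian_endo.endo_one[OF endo_funpow])
  show ?case using pCons assms one
    by (simp add: pact_pCons pcompose_pCons pact_add pact_mult pact_monom pact_const)
qed simp

end

section \<open>Torsion, annihilating polynomials and the dichotomy between periodic and expanding
  elements\<close>

definition noetherian_group :: "('a, 'm) monoid_scheme \<Rightarrow> bool" where
  "noetherian_group G \<longleftrightarrow> (\<forall>H. subgroup H G \<longrightarrow> (\<exists>S. finite S \<and> S \<subseteq> H \<and> generate G S = H))"

text \<open>Adjoining one generator \<open>s\<close> multiplies the order by at most
  \<open>n\<close>: every element has the form \<open>s [^] i \<otimes> g\<close> with
  \<open>i < n\<close>.\<close>

lemma (in comm_group) finite_generate_torsion: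
  fixes n :: nat
  assumes "finite S" "S \<subseteq> carrier G" "n > 0" "\<And>s. s \<in> S \<Longrightarrow> s [^] n = \<one>"
  shows "finite (generate G S)"
  using assms
proof (induction S rule: finite_induct)
  case empty
  then show ?case by (simp add: generate_empty)
next
  case (insert s S)
  have fin: "finite (generate G S)" using insert by auto
  have s: "s \<in> carrier G" and S: "S \<subseteq> carrier G" using insert.prems by auto
  interpret K: subgroup "generate G S" G by (rule generate_is_subgroup[OF S])
  let ?F = "(\<lambda>(i, g). s [^] (i::nat) \<otimes> g) ` ({..<n} \<times> generate G S)"
  have red: "s [^] (i::nat) \<otimes> g \<in> ?F" if "g \<in> generate G S" for i g
  proof -
    have "s [^] i = s [^] (i mod n)"
    proof -
      have "s [^] i = s [^] (n * (i div n) + i mod n)" by simp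
      also have "\<dots> = s [^] (n * (i div n)) \<otimes> s [^] (i mod n)" using s by (simp only: nat_pow_mult)
      also have "s [^] (n * (i div n)) = \<one>"
        using s insert.prems(3)[of s] nat_pow_pow[of s n "i div n"] by simp
      finally show ?thesis using s by simp
    qed
    then show ?thesis using that insert.prems(2) by force
  qed
  have "generate G (insert s S) \<subseteq> ?F"
  proof
    fix x assume "x \<in> generate G (insert s S)"
    then show "x \<in> ?F"
    proof (induction rule: generate.induct)
      case one
      show ?case using red[of \<one> 0] K.one_closed by simp
    next
      case (incl h)
      show ?case
      proof (cases "h = s")
        case True
        then show ?thesis using red[of \<one> 1] K.one_closed s by simp
      next
        case False
        then have "h \<in> generate G S" using incl by (auto intro: generate.incl)
        then show ?thesis using red[of h 0] K.mem_carrier by simp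
      qed
    next
      case (inv h)
      show ?case
      proof (cases "h = s")
        case True
        have "s [^] (n - 1) \<otimes> s = \<one>"
          using insert.prems(2,3) s by (metis Suc_diff_1 insertI1 nat_pow_Suc)
        then have "inv s = s [^] (n - 1)" using s by (intro inv_equality) auto
        then show ?thesis using red[of \<one> "n - 1"] K.one_closed s True by simp
      next
        case False
        then have "inv h \<in> generate G S" using inv by (auto intro: generate.inv)
        then show ?thesis using red[of "inv h" 0] K.mem_carrier by simp
      qed
    next
      case (eng h1 h2)
      obtain i :: nat and g where 1: "h1 = s [^] i \<otimes> g" "g \<in> generate G S"
        using eng.IH(1) by (auto simp: image_iff)
      obtain j :: nat and g' where 2: "h2 = s [^] j \<otimes> g'" "g' \<in> generate G S"
        using eng.IH(2) by (auto simp: image_iff)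
      note g = 1(2) 2(2)
      have "g \<in> carrier G" "g' \<in> carrier G" using g K.mem_carrier by auto
      with 1 2 have "h1 \<otimes> h2 = s [^] (i + j) \<otimes> (g \<otimes> g')"
        using s by (simp add: nat_pow_mult[symmetric] m_ac)
      then show ?case using red[of "g \<otimes> g'" "i + j"] g by simp
    qed
  qed
  then show ?case using fin finite_subset by blast
qed

text \<open>These are the differences of two distinct polynomials with coefficients 0 and 1. If none
  of them kills an element, the subset sums of its orbit are pairwise distinct.\<close>

definition unit_polys :: "int poly set" where
  "unit_polys = {f. f \<noteq> 0 \<and> (\<forall>i. coeff f i \<in> {-1, 0, 1})}"

context abelian_endo
begin

lemma periodic_of_finite_orbit:
  assumes "inj_on \<sigma> (carrier A)" "w \<in> carrier A" "(\<sigma> ^^ k) w = (\<sigma> ^^ l) w" "k < l"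
  shows "\<exists>k>0. (\<sigma> ^^ k) w = w"
proof (intro exI[of _ "l - k"] conjI)
  have inj: "inj_on (\<sigma> ^^ k) (carrier A)"
  proof (induction k)
    case (Suc k)
    then show ?case
      using comp_inj_on[OF Suc, of \<sigma>] assms(1) inj_on_subset[of \<sigma> "carrier A" "(\<sigma> ^^ k) ` carrier A"]
      by (auto simp: image_subset_iff comp_def)
  qed simp
  have "(\<sigma> ^^ k) ((\<sigma> ^^ (l - k)) w) = (\<sigma> ^^ k) w"
    using assms(3,4) by (simp flip: funpow_add[unfolded fun_eq_iff comp_def, rule_format])
  then show "(\<sigma> ^^ (l - k)) w = w"
    using inj assms(2) by (auto dest: inj_onD)
qed (use assms in auto)

text \<open>The cyclic module generated by \<open>w\<close> is finitely generated as a group, so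
  polynomials of degree below some \<open>m\<close> already reach all of it. Expressing
  \<open>(\<sigma> ^^ m) w\<close> by them gives a monic relation.\<close>

lemma monic_annihilator:
  assumes "noetherian_group A" "w \<in> carrier A"
  shows "\<exists>P. lead_coeff P = 1 \<and> pact A \<sigma> P w = \<one>"
proof -
  let ?U = "range (\<lambda>p. pact A \<sigma> p w)"
  have sub: "subgroup ((\<lambda>p. pact A \<sigma> p w) ` X) A"
    if "0 \<in> X" "\<And>p q. p \<in> X \<Longrightarrow> q \<in> X \<Longrightarrow> p + q \<in> X" "\<And>p. p \<in> X \<Longrightarrow> - p \<in> X" for X
  proof (rule subgroupI)
    show "(\<lambda>p. pact A \<sigma> p w) ` X \<subseteq> carrier A" using assms by auto
    show "(\<lambda>p. pact A \<sigma> p w) ` X \<noteq> {}" using that by auto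
  next
    fix a assume "a \<in> (\<lambda>p. pact A \<sigma> p w) ` X"
    then show "inv a \<in> (\<lambda>p. pact A \<sigma> p w) ` X"
      using that(3) by (auto simp: pact_uminus[OF assms(2), symmetric])
  next
    fix a b assume "a \<in> (\<lambda>p. pact A \<sigma> p w) ` X" "b \<in> (\<lambda>p. pact A \<sigma> p w) ` X"
    then show "a \<otimes> b \<in> (\<lambda>p. pact A \<sigma> p w) ` X"
      using that(2) by (auto simp: pact_add[OF assms(2), symmetric])
  qed
  have "subgroup ?U A" using sub[of UNIV] by simp
  then obtain S where S: "finite S" "S \<subseteq> ?U" "generate A S = ?U"
    using assms(1) unfolding noetherian_group_def by meson
  have "\<forall>s\<in>S. \<exists>p. s = pact A \<sigma> p w" using S(2) by (simp add: subset_iff image_iff)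
  then obtain f where f: "\<And>s. s \<in> S \<Longrightarrow> s = pact A \<sigma> (f s) w" by metis
  define m where "m = Suc (\<Sum>s\<in>S. degree (f s))"
  let ?V = "(\<lambda>p. pact A \<sigma> p w) ` {p. degree p < m}"
  have "subgroup ?V A" by (rule sub) (auto simp: m_def degree_add_less)
  moreover have "S \<subseteq> ?V"
  proof
    fix s assume s: "s \<in> S"
    have "degree (f s) \<le> (\<Sum>s\<in>S. degree (f s))" by (rule member_le_sum) (use s S in auto)
    then show "s \<in> ?V" using f[OF s] by (auto simp: m_def)
  qed
  ultimately have "generate A S \<subseteq> ?V" by (rule generate_subgroup_incl[rotated])
  then have "pact A \<sigma> (monom 1 m) w \<in> ?V" using S(3) by blast
  then obtain p where p: "degree p < m" "pact A \<sigma> (monom 1 m) w = pact A \<sigma> p w" by auto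
  have dm: "degree (monom 1 m :: int poly) = m" by (simp add: degree_monom_eq)
  have "degree (monom 1 m - p) = m"
    using p(1) degree_add_eq_left[of "-p" "monom 1 m"] dm by simp
  then have "lead_coeff (monom 1 m - p) = 1" using p(1) by (simp add: coeff_eq_0)
  moreover have "pact A \<sigma> (monom 1 m - p) w = \<one>" using assms(2) p(2) by (simp add: pact_diff)
  ultimately show ?thesis by blast
qed

text \<open>Division with remainder by the monic \<open>P\<close>, one coefficient at a time: after
  a multiplication by x, only the coefficient at \<open>degree P\<close> has to be cleared. The
  degree bound is independent of \<open>p\<close>, and this lets one integer \<open>N\<close> serve
  all powers of \<open>\<sigma>\<close> in \<open>periodic_or_expanding\<close>.\<close>

lemma reduce_monic:
  assumes "w \<in> carrier A" "lead_coeff P = 1" "pact A \<sigma> P w = \<one>" "degree P > 0"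
  shows "\<exists>r. degree r < degree P \<and> pact A \<sigma> r w = pact A \<sigma> p w"
proof (induction p)
  case 0
  then show ?case using assms by (intro exI[of _ 0]) auto
next
  case (pCons c p)
  then obtain r where r: "degree r < degree P" "pact A \<sigma> r w = pact A \<sigma> p w" by blast
  define a where "a = coeff (pCons c r) (degree P)"
  define s where "s = pCons c r - smult a P"
  have deg: "degree (pCons c r) \<le> degree P" using r(1) by (cases "r = 0") auto
  have "degree s < degree P"
  proof (rule degree_lessI)
    show "s \<noteq> 0 \<or> degree P > 0" using assms by simp
    show "\<forall>k\<ge>degree P. coeff s k = 0"
    proof (intro allI impI)
      fix k assume "k \<ge> degree P"
      then show "coeff s k = 0"
        using deg assms(2) by (cases "k = degree P") (auto simp: s_def a_def coeff_eq_0)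
    qed
  qed
  moreover have "pact A \<sigma> s w = pact A \<sigma> (pCons c p) w"
    using assms r by (simp add: s_def pact_diff pact_smult pact_pCons)
  ultimately show ?case by blast
qed

text \<open>Torsion is treated first, because pseudo-division introduces integer factors that must
  be cancelled afterwards. In the torsion-free case the roots of an annihilating polynomial of least
  degree decide: a root of modulus above 1 gives an expanding element, and roots in the closed unit
  disc give a periodic one.\<close>

theorem periodic_or_expanding:
  assumes inj: "inj_on \<sigma> (carrier A)" and noeth: "noetherian_group A" and ne: "carrier A \<noteq> {\<one>}"
  shows "(\<exists>w\<in>carrier A. w \<noteq> \<one> \<and> (\<exists>k>0. (\<sigma> ^^ k) w = w)) \<or>
    (\<exists>w\<in>carrier A. \<exists>k. \<forall>F. finite F \<and> F \<subseteq> unit_polys \<longrightarrow> pact A (\<sigma> ^^ k) (\<Prod>F) w \<noteq> \<one>)"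
proof (cases "\<exists>t\<in>carrier A. t \<noteq> \<one> \<and> (\<exists>n::nat. n > 0 \<and> t [^] n = \<one>)")
  case True
  then obtain t and n :: nat where t: "t \<in> carrier A" "t \<noteq> \<one>" and n: "n > 0" "t [^] n = \<one>" by blast
  \<comment> \<open>The elements killed by \<open>n\<close> form a finite subgroup that contains the
    whole orbit of \<open>t\<close>, so this orbit repeats.\<close>
  define T where "T = {a \<in> carrier A. a [^] n = \<one>}"
  have "subgroup T A"
    by (rule subgroupI) (auto simp: T_def nat_pow_distrib nat_pow_inv intro!: exI[of _ \<one>])
  then obtain S where S: "finite S" "S \<subseteq> T" "generate A S = T"
    using noeth unfolding noetherian_group_def by blast
  then have "finite T" using finite_generate_torsion[of S n] n by (auto simp: T_def)
  moreover have in_T: "(\<sigma> ^^ k) t \<in> T" for k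
  proof (induction k)
    case (Suc k)
    have "\<sigma> ((\<sigma> ^^ k) t) [^] n = \<sigma> ((\<sigma> ^^ k) t [^] n)"
      using endo_int_pow[of "(\<sigma> ^^ k) t" "int n"] t(1) by (simp add: int_pow_int)
    also have "\<dots> = \<one>" using Suc unfolding T_def by (simp only: mem_Collect_eq endo_one)
    finally show ?case using Suc by (simp add: T_def)
  qed (use t n in \<open>simp add: T_def\<close>)
  ultimately have "finite (range (\<lambda>k. (\<sigma> ^^ k) t))" by (blast intro: finite_subset)
  then have "\<not> inj (\<lambda>k. (\<sigma> ^^ k) t)" using finite_imageD infinite_UNIV_nat by blast
  then obtain k l where "k < l" "(\<sigma> ^^ k) t = (\<sigma> ^^ l) t" unfolding inj_def by (metis nat_neq_iff)
  then have "\<exists>k>0. (\<sigma> ^^ k) t = t" using periodic_of_finite_orbit[OF inj t(1)] by simp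
  then show ?thesis using t by (intro disjI1 bexI[of _ t]) auto
next
  case torsion_free: False
  have tf: "a = \<one>" if "a \<in> carrier A" "a [^] (c::int) = \<one>" "c \<noteq> 0" for a c
  proof -
    define n where "n = nat \<bar>c\<bar>"
    have n0: "n > 0" using that(3) by (simp add: n_def)
    have "c = int n \<or> c = - int n" by (auto simp: n_def)
    then have "a [^] n = \<one>"
    proof
      assume "c = int n"
      then show ?thesis using that(2) by (simp add: int_pow_int)
    next
      assume "c = - int n"
      then have "inv (a [^] n) = \<one>" using that(1,2) by (simp add: int_pow_neg int_pow_int)
      then show ?thesis using that(1) by simp
    qed
    then show ?thesis using torsion_free that(1) n0 by blast
  qed
  define ann where "ann d \<longleftrightarrow> (\<exists>w q. w \<in> carrier A \<and> w \<noteq> \<one> \<and> q \<noteq> 0 \<and> degree q = d \<and> pact A \<sigma> q w = \<one>)" for d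
  obtain u where u: "u \<in> carrier A" "u \<noteq> \<one>" using ne by blast
  obtain P0 where "lead_coeff P0 = 1" "pact A \<sigma> P0 u = \<one>" using monic_annihilator noeth u by blast
  then have "ann (degree P0)" using u unfolding ann_def by (intro exI[of _ u] exI[of _ P0]) auto
  define e where "e = (LEAST d. ann d)"
  have "ann e" unfolding e_def by (rule LeastI) fact
  then obtain w q where w: "w \<in> carrier A" "w \<noteq> \<one>" and q: "q \<noteq> 0" "degree q = e" "pact A \<sigma> q w = \<one>"
    unfolding ann_def by blast
  have min: "e \<le> degree p" if "v \<in> carrier A" "v \<noteq> \<one>" "p \<noteq> 0" "pact A \<sigma> p v = \<one>" for v p
    unfolding e_def by (rule Least_le) (use that ann_def in blast)
  have e0: "e > 0"
  proof (rule ccontr)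
    assume "\<not> e > 0"
    then obtain c where "q = [:c:]" using q degree_eq_zeroE by blast
    then show False using q w tf[of w c] by (simp add: pact_const)
  qed
  let ?C = "of_int_poly :: int poly \<Rightarrow> complex poly"
  \<comment> \<open>Minimality of \<open>e\<close> over all \<open>w\<close> makes \<open>q\<close> irreducible over the rationals.\<close>
  have annihilates_root: "poly (?C p) z = 0" if "pact A \<sigma> p w = \<one>" "poly (?C q) z = 0" for p z
  proof -
    \<comment> \<open>Pseudo-division keeps the coefficients integral at the price of the factor
      \<open>a\<close>. The remainder still annihilates \<open>w\<close>, so minimality of
      \<open>e\<close> makes it vanish.\<close>
    define r where "r = pseudo_mod p q"
    obtain a s where as: "a \<noteq> 0" "smult a p = q * s + r" and r: "r = 0 \<or> degree r < degree q"
      using pseudo_mod[OF q(1), of p] by (auto simp: r_def)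
    have "pact A \<sigma> (smult a p) w = \<one>" using w that by (simp add: pact_smult)
    moreover have "pact A \<sigma> (q * s) w = \<one>" using w q by (simp add: mult.commute[of q] pact_mult)
    ultimately have "pact A \<sigma> r w = \<one>" using w by (simp add: as(2) pact_add)
    then have "r = 0" using min[of w r] w r q(2) by force
    then have "?C (smult a p) = ?C q * ?C s" using as by (simp add: of_int_poly_mult)
    then have "poly (?C (smult a p)) z = 0" using that(2) by simp
    then show ?thesis using as(1) by (simp add: of_int_poly_smult)
  qed
  have min_root: "e \<le> degree p" if "p \<noteq> 0" "poly (?C p) z = 0" "poly (?C q) z = 0" for p z
  proof -
    \<comment> \<open>\<open>m\<close> is a minimal polynomial of \<open>z\<close> with integer
      coefficients. It divides \<open>q\<close> up to an integer factor, and the claim becomes that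
      the cofactor \<open>s\<close> is constant.\<close>
    define d where "d = (LEAST d. \<exists>p. p \<noteq> 0 \<and> poly (?C p) z = 0 \<and> degree p = d)"
    have "\<exists>p. p \<noteq> 0 \<and> poly (?C p) z = 0 \<and> degree p = d"
      unfolding d_def by (rule LeastI[of _ "degree p"]) (use that in blast)
    then obtain m where m: "m \<noteq> 0" "poly (?C m) z = 0" "degree m = d" by blast
    have dmin: "d \<le> degree p" if "p \<noteq> 0" "poly (?C p) z = 0" for p
      unfolding d_def by (rule Least_le) (use that in blast)
    have d0: "d > 0"
    proof (rule ccontr)
      assume "\<not> d > 0"
      then obtain c where "m = [:c:]" using m degree_eq_zeroE by blast
      then show False using m by (simp add: map_poly_pCons)
    qed
    define r where "r = pseudo_mod q m"
    obtain a s where as: "a \<noteq> 0" "smult a q = m * s + r" and r: "r = 0 \<or> degree r < degree m"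
      using pseudo_mod[OF m(1), of q] by (auto simp: r_def)
    have "?C r = smult (of_int a) (?C q) - ?C m * ?C s"
      using arg_cong[OF as(2), of ?C] by (simp add: of_int_poly_add of_int_poly_mult of_int_poly_smult)
    then have "poly (?C r) z = 0" using m(2) that(3) by simp
    then have "r = 0" using dmin[of r] r m(3) by force
    then have ms: "smult a q = m * s" using as(2) by simp
    then have s0: "s \<noteq> 0" using as(1) q(1) by auto
    have "e = d + degree s"
      using arg_cong[OF ms, of degree] m s0 as(1) q(2) by (simp add: degree_mult_eq)
    have "pact A \<sigma> (smult a q) w = \<one>" using q(3) w by (simp add: pact_smult)
    then have *: "pact A \<sigma> m (pact A \<sigma> s w) = \<one>" using w by (simp add: ms pact_mult)
    \<comment> \<open>Either the cofactor \<open>s\<close> already kills \<open>w\<close>, or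
      \<open>m\<close> kills the nontrivial element \<open>pact A \<sigma> s w\<close>. The second
      case requires \<open>e\<close> to be minimal over all nontrivial elements and not only for
      \<open>w\<close>.\<close>
    have "e \<le> d"
    proof (cases "pact A \<sigma> s w = \<one>")
      case True
      then have "e \<le> degree s" using min[OF w s0] by simp
      then show ?thesis using \<open>e = d + degree s\<close> d0 by simp
    next
      case False
      then show ?thesis using min[OF _ False m(1) *] w m(3) by simp
    qed
    then show ?thesis using dmin[OF that(1,2)] by simp
  qed
  show ?thesis
  proof (cases "\<exists>z. poly (?C q) z = 0 \<and> norm z > 1")
    case True
    then obtain z where z: "poly (?C q) z = 0" "norm z > 1" by blast
    \<comment> \<open>Passing to \<open>\<sigma> ^^ k\<close> replaces the root \<open>z\<close> by
      \<open>z ^ k\<close>, which lies in the range where \<open>poly_unit_coeffs_neq_0\<close>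
      applies.\<close>
    obtain k where k: "2 < norm z ^ k" using real_arch_pow[OF z(2)] by blast
    have "pact A (\<sigma> ^^ k) (\<Prod>F) w \<noteq> \<one>" if F: "finite F" "F \<subseteq> unit_polys" for F
    proof
      assume "pact A (\<sigma> ^^ k) (\<Prod>F) w = \<one>"
      then have "pact A \<sigma> (pcompose (\<Prod>F) (monom 1 k)) w = \<one>" using w by (simp add: pact_funpow)
      then have "poly (?C (pcompose (\<Prod>F) (monom 1 k))) z = 0" using annihilates_root z(1) by blast
      moreover have "?C (pcompose p (monom 1 k)) = pcompose (?C p) (monom 1 k)" for p
        by (induction p) (simp_all add: pcompose_pCons of_int_poly_add of_int_poly_mult of_int_poly_monom map_poly_pCons)
      ultimately have "poly (?C (\<Prod>F)) (z ^ k) = 0" by (simp add: poly_pcompose poly_monom)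
      then have "(\<Prod>f\<in>F. poly (?C f) (z ^ k)) = 0" by (simp add: of_int_poly_prod poly_prod)
      then obtain f where "f \<in> F" "poly (?C f) (z ^ k) = 0" using F(1) by auto
      then show False
        using poly_unit_coeffs_neq_0[of f "z ^ k"] F(2) k by (auto simp: unit_polys_def norm_power)
    qed
    then show ?thesis using w by blast
  next
    case False
    then have roots: "norm z \<le> 1" if "poly (?C q) z = 0" for z using that by force
    have sqf: "rsquarefree (?C q)"
      unfolding rsquarefree_roots
    proof (intro allI notI)
      fix z assume z: "poly (?C q) z = 0 \<and> poly (pderiv (?C q)) z = 0"
      \<comment> \<open>A double root would be a root of the derivative, whose degree
        \<open>e - 1\<close> contradicts \<open>min_root\<close>.\<close>
      have "pderiv q \<noteq> 0" using e0 q(2) by (simp add: pderiv_eq_0_iff)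
      then have "e \<le> degree (pderiv q)" using min_root[of "pderiv q" z] z by (simp add: pderiv_of_int_poly)
      then show False using e0 q(2) by (simp add: degree_pderiv)
    qed
    obtain P where P: "lead_coeff P = 1" "pact A \<sigma> P w = \<one>" using monic_annihilator noeth w by blast
    have "P \<noteq> 0" using P(1) by auto
    have degP: "degree P > 0" using min[OF w \<open>P \<noteq> 0\<close> P(2)] e0 by simp
    \<comment> \<open>Pseudo-division of \<open>p\<close> by \<open>q\<close> multiplies by
      \<open>lead_coeff q\<close> to the power \<open>Suc (degree p) - degree q\<close>. Since
      \<open>degree p < degree P\<close>, this exponent is at most \<open>degree P\<close>; the
      factor \<open>a\<close> below pads it to exactly \<open>degree P\<close>, so that
      \<open>N\<close> does not depend on \<open>k\<close>.\<close>
    define N where "N = lead_coeff q ^ degree P"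
    have N0: "N \<noteq> 0" using q(1) by (simp add: N_def)
    have "\<exists>r. degree r < e \<and> pact A \<sigma> r w = (\<sigma> ^^ k) w [^] N" for k
    proof -
      obtain p where p: "degree p < degree P" "pact A \<sigma> p w = pact A \<sigma> (monom 1 k) w"
        using reduce_monic[OF w(1) P degP] by blast
      obtain s r where sr: "pseudo_divmod p q = (s, r)" by (cases "pseudo_divmod p q")
      note pd = pseudo_divmod[OF q(1) sr]
      define a where "a = lead_coeff q ^ (degree P - (Suc (degree p) - degree q))"
      define c where "c = lead_coeff q ^ (Suc (degree p) - degree q)"
      have ca: "c * a = N" unfolding c_def a_def N_def power_add[symmetric] using p(1) by simp
      have "pact A \<sigma> (smult c p) w = pact A \<sigma> r w"
        using pd(1) q(3) w by (simp add: c_def pact_add mult.commute[of q] pact_mult)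
      then have "pact A \<sigma> (smult a r) w = (pact A \<sigma> p w [^] c) [^] a"
        using w by (simp add: pact_smult)
      also have "\<dots> = (\<sigma> ^^ k) w [^] N"
        using w p(2) by (simp add: int_pow_pow ca pact_monom)
      finally have "pact A \<sigma> (smult a r) w = (\<sigma> ^^ k) w [^] N" .
      moreover have "degree (smult a r) < e" using pd(2) q(2) e0 by auto
      ultimately show ?thesis by blast
    qed
    then obtain r where r: "\<And>k. degree (r k) < e" "\<And>k. pact A \<sigma> (r k) w = (\<sigma> ^^ k) w [^] N" by metis
    have "poly (?C (r k)) z = of_int N * z ^ k" if "poly (?C q) z = 0" for k z
    proof -
      have "pact A \<sigma> (smult N (monom 1 k) - r k) w = \<one>"
        using w r by (simp add: pact_diff pact_smult pact_monom)
      from annihilates_root[OF this that] show ?thesis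
        by (simp add: of_int_poly_diff of_int_poly_smult of_int_poly_monom poly_monom)
    qed
    then obtain k l where "k < l" "r k = r l"
      using bounded_remainders_repeat[OF sqf roots, of r N] r(1) q(2) by blast
    \<comment> \<open>Equal remainders give equal \<open>N\<close>-th powers, and absence of torsion
      cancels \<open>N\<close>.\<close>
    then have "(\<sigma> ^^ k) w [^] N = (\<sigma> ^^ l) w [^] N" using r(2) by metis
    then have "((\<sigma> ^^ k) w \<otimes> inv ((\<sigma> ^^ l) w)) [^] N = \<one>"
      using w by (simp add: int_pow_distrib int_pow_inv)
    then have "(\<sigma> ^^ k) w \<otimes> inv ((\<sigma> ^^ l) w) = \<one>" using tf N0 w by simp
    then have "inv (inv ((\<sigma> ^^ l) w)) = (\<sigma> ^^ k) w" by (rule inv_equality) (use w in simp_all)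
    then have "(\<sigma> ^^ k) w = (\<sigma> ^^ l) w" using w by simp
    then have "\<exists>k>0. (\<sigma> ^^ k) w = w" using periodic_of_finite_orbit[OF inj w(1) _ \<open>k < l\<close>] by simp
    then show ?thesis using w by (intro disjI1 bexI[of _ w]) auto
  qed
qed

end

section \<open>Abelian sections and exponential growth\<close>

definition conjg :: "('a, 'm) monoid_scheme \<Rightarrow> 'a \<Rightarrow> 'a \<Rightarrow> 'a" where
  "conjg G h m = h \<otimes>\<^bsub>G\<^esub> m \<otimes>\<^bsub>G\<^esub> inv\<^bsub>G\<^esub> h"

definition commutator :: "('a, 'm) monoid_scheme \<Rightarrow> 'a \<Rightarrow> 'a \<Rightarrow> 'a" where
  "commutator G x y = x \<otimes>\<^bsub>G\<^esub> y \<otimes>\<^bsub>G\<^esub> inv\<^bsub>G\<^esub> x \<otimes>\<^bsub>G\<^esub> inv\<^bsub>G\<^esub> y"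

context group
begin

lemma conjg_closed [simp, intro]: "h \<in> carrier G \<Longrightarrow> m \<in> carrier G \<Longrightarrow> conjg G h m \<in> carrier G"
  by (simp add: conjg_def)

lemma commutator_closed [simp, intro]: "h \<in> carrier G \<Longrightarrow> m \<in> carrier G \<Longrightarrow> commutator G h m \<in> carrier G"
  by (simp add: commutator_def)

lemma conjg_one_right [simp]: "h \<in> carrier G \<Longrightarrow> conjg G h \<one> = \<one>"
  by (simp add: conjg_def)

lemma conjg_one_left [simp]: "m \<in> carrier G \<Longrightarrow> conjg G \<one> m = m"
  by (simp add: conjg_def)

lemma inv_mult_cancel_left [simp]: "x \<in> carrier G \<Longrightarrow> y \<in> carrier G \<Longrightarrow> inv x \<otimes> (x \<otimes> y) = y"
  by (simp flip: m_assoc)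

lemma mult_inv_cancel_left [simp]: "x \<in> carrier G \<Longrightarrow> y \<in> carrier G \<Longrightarrow> x \<otimes> (inv x \<otimes> y) = y"
  by (simp flip: m_assoc)

lemma conjg_mult_right:
  "h \<in> carrier G \<Longrightarrow> a \<in> carrier G \<Longrightarrow> b \<in> carrier G \<Longrightarrow> conjg G h (a \<otimes> b) = conjg G h a \<otimes> conjg G h b"
  by (simp add: conjg_def m_assoc)

lemma conjg_mult_left:
  "g \<in> carrier G \<Longrightarrow> h \<in> carrier G \<Longrightarrow> a \<in> carrier G \<Longrightarrow> conjg G (g \<otimes> h) a = conjg G g (conjg G h a)"
  by (simp add: conjg_def m_assoc inv_mult_group)

lemma conjg_inv_right: "h \<in> carrier G \<Longrightarrow> a \<in> carrier G \<Longrightarrow> conjg G h (inv a) = inv (conjg G h a)"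
  by (simp add: conjg_def m_assoc inv_mult_group)

lemma conjg_inv_cancel [simp]:
  "h \<in> carrier G \<Longrightarrow> a \<in> carrier G \<Longrightarrow> conjg G (inv h) (conjg G h a) = a"
  "h \<in> carrier G \<Longrightarrow> a \<in> carrier G \<Longrightarrow> conjg G h (conjg G (inv h) a) = a"
  by (simp_all flip: conjg_mult_left)

lemma rcos_eq_iff:
  assumes "subgroup H G" "x \<in> carrier G" "y \<in> carrier G"
  shows "H #> x = H #> y \<longleftrightarrow> x \<otimes> inv y \<in> H"
  by (metis assms group.repr_independence is_group rcos_self subgroup.rcos_module_imp subgroup.rcos_module_rev)

lemma lcos_eq_iff:
  assumes "subgroup H G" "x \<in> carrier G" "y \<in> carrier G"
  shows "x <# H = y <# H \<longleftrightarrow> inv x \<otimes> y \<in> H"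
proof
  assume "x <# H = y <# H"
  moreover have "y \<otimes> \<one> \<in> y <# H" using subgroup.one_closed[OF assms(1)] unfolding l_coset_def by blast
  ultimately have "y \<in> x <# H" using assms by simp
  then obtain h where "h \<in> H" "y = x \<otimes> h" unfolding l_coset_def by blast
  then show "inv x \<otimes> y \<in> H" using assms subgroup.mem_carrier by fastforce
next
  assume "inv x \<otimes> y \<in> H"
  then have "x \<otimes> (inv x \<otimes> y) \<in> x <# H" unfolding l_coset_def by blast
  then have "y \<in> x <# H" using assms by simp
  then show "x <# H = y <# H" using l_repr_independence[OF _ assms(2,1)] by blast
qed

lemma normal_conjg_closed: "N \<lhd> G \<Longrightarrow> h \<in> carrier G \<Longrightarrow> m \<in> N \<Longrightarrow> conjg G h m \<in> N"
  unfolding conjg_def by (rule normal.inv_op_closed2)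

lemma normalI_conjg:
  assumes "subgroup N G" "\<And>g n. g \<in> carrier G \<Longrightarrow> n \<in> N \<Longrightarrow> conjg G g n \<in> N"
  shows "N \<lhd> G"
  by (rule normal_invI[OF assms(1)]) (use assms(2) in \<open>simp add: conjg_def\<close>)

end

text \<open>\<open>M\<close> is only a subgroup: in \<open>ex_finite_orbit\<close> the section
  consists of the elements with finite orbit under one term of the polycyclic series, and its
  invariance is established only for conjugation by an element of the next term. Lemmas about the
  action of \<open>h\<close> therefore assume \<open>conjg G h\<close> together with its image of
  \<open>M\<close> lying in \<open>M\<close>.\<close>

locale abelian_section = group G for G (structure) +
  fixes N M
  assumes N_normal: "N \<lhd> G" and M_subgroup: "subgroup M G" and N_le_M: "N \<subseteq> M"
    and comm_in_N: "\<And>x y. x \<in> M \<Longrightarrow> y \<in> M \<Longrightarrow> commutator G x y \<in> N"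
begin

definition "Q = G\<lparr>carrier := M\<rparr> Mod N"

lemma N_subgroup: "subgroup N G"
  by (rule normal_imp_subgroup[OF N_normal])

lemma M_carrier [simp]: "m \<in> M \<Longrightarrow> m \<in> carrier G"
  by (rule subgroup.mem_carrier[OF M_subgroup])

lemma N_normal_M: "N \<lhd> G\<lparr>carrier := M\<rparr>"
  by (rule normal_restrict_supergroup[OF M_subgroup N_normal N_le_M])

lemma group_M: "group (G\<lparr>carrier := M\<rparr>)"
  by (rule subgroup_imp_group[OF M_subgroup])

lemma group_Q: "group Q"
  unfolding Q_def using N_normal_M by (rule normal.factorgroup_is_group)

lemma carrier_Q: "carrier Q = (\<lambda>m. N #> m) ` M"
  by (simp add: Q_def carrier_FactGroup)

lemma one_Q: "\<one>\<^bsub>Q\<^esub> = N"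
  by (simp add: Q_def)

lemma proj_hom: "(\<lambda>m. N #> m) \<in> hom (G\<lparr>carrier := M\<rparr>) Q"
  using normal.r_coset_hom_Mod[OF N_normal_M] by (simp add: Q_def)

lemma proj_group_hom: "group_hom (G\<lparr>carrier := M\<rparr>) Q (\<lambda>m. N #> m)"
  by (simp add: group_hom_def group_hom_axioms_def group_M group_Q proj_hom)

lemma mult_Q: "a \<in> M \<Longrightarrow> b \<in> M \<Longrightarrow> (N #> a) \<otimes>\<^bsub>Q\<^esub> (N #> b) = N #> (a \<otimes> b)"
  using proj_hom by (simp add: hom_def)

lemma inv_Q: "a \<in> M \<Longrightarrow> inv\<^bsub>Q\<^esub> (N #> a) = N #> inv a"
  using group_hom.hom_inv[OF proj_group_hom, of a] m_inv_consistent[OF M_subgroup, of a] by simp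

lemma proj_eq_iff: "a \<in> M \<Longrightarrow> b \<in> M \<Longrightarrow> N #> a = N #> b \<longleftrightarrow> a \<otimes> inv b \<in> N"
  by (simp add: rcos_eq_iff[OF N_subgroup])

lemma proj_eq_one_iff: "a \<in> M \<Longrightarrow> N #> a = N \<longleftrightarrow> a \<in> N"
  using coset_join1[of N a] coset_join2[of a N] N_subgroup subgroup.subset[OF N_subgroup] by auto

lemma comm_group_Q: "comm_group Q"
proof -
  have "x \<otimes>\<^bsub>Q\<^esub> y = y \<otimes>\<^bsub>Q\<^esub> x" if "x \<in> carrier Q" "y \<in> carrier Q" for x y
  proof -
    from that obtain a b where ab: "a \<in> M" "b \<in> M" and xy: "x = N #> a" "y = N #> b"
      unfolding carrier_Q by auto
    have "(a \<otimes> b) \<otimes> inv (b \<otimes> a) = commutator G a b"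
      using ab by (simp add: commutator_def inv_mult_group m_assoc)
    then have "N #> (a \<otimes> b) = N #> (b \<otimes> a)"
      using ab comm_in_N M_subgroup by (subst proj_eq_iff) (auto simp: subgroup.m_closed)
    then show ?thesis using xy ab by (simp add: mult_Q)
  qed
  then show ?thesis by (rule group.group_comm_groupI[OF group_Q])
qed

lemma noetherian_Q:
  assumes "noetherian_group G"
  shows "noetherian_group Q"
  unfolding noetherian_group_def
proof (intro allI impI)
  fix K assume K: "subgroup K Q"
  define P where "P = {m \<in> M. N #> m \<in> K}"
  have "subgroup P G"
  proof (rule subgroupI)
    show "P \<subseteq> carrier G" by (auto simp: P_def)
    have "\<one> \<in> P" using subgroup.one_closed[OF K] subgroup.one_closed[OF M_subgroup] subgroup.subset[OF N_subgroup]
      by (simp add: P_def one_Q)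
    then show "P \<noteq> {}" by blast
  qed (use K M_subgroup in \<open>auto simp: P_def inv_Q[symmetric] mult_Q[symmetric] subgroup.m_inv_closed subgroup.m_closed\<close>)
  then obtain S where S: "finite S" "S \<subseteq> P" "generate G S = P"
    using assms unfolding noetherian_group_def by blast
  have "generate Q ((\<lambda>m. N #> m) ` S) = (\<lambda>m. N #> m) ` generate (G\<lparr>carrier := M\<rparr>) S"
    using S(2) by (intro group_hom.generate_img[OF proj_group_hom]) (auto simp: P_def)
  also have "generate (G\<lparr>carrier := M\<rparr>) S = P"
    using generate_consistent[of S M] S M_subgroup by (simp add: P_def subset_iff)
  also have "(\<lambda>m. N #> m) ` P = K" using subgroup.subset[OF K] by (auto simp: P_def carrier_Q)
  finally show "\<exists>S. finite S \<and> S \<subseteq> K \<and> generate Q S = K"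
    using S by (intro exI[of _ "(\<lambda>m. N #> m) ` S"]) (auto simp: P_def)
qed

lemma conjg_image_coset:
  assumes h: "h \<in> carrier G" and m: "m \<in> M"
  shows "conjg G h ` (N #> m) = N #> conjg G h m"
proof
  have Nc: "n \<in> carrier G" if "n \<in> N" for n
    using that by (rule subgroup.mem_carrier[OF N_subgroup])
  show "conjg G h ` (N #> m) \<subseteq> N #> conjg G h m"
    unfolding r_coset_def using h m Nc normal_conjg_closed[OF N_normal h] by (auto simp: conjg_mult_right)
  show "N #> conjg G h m \<subseteq> conjg G h ` (N #> m)"
  proof
    fix x assume "x \<in> N #> conjg G h m"
    then obtain n where n: "n \<in> N" "x = n \<otimes> conjg G h m" unfolding r_coset_def by auto
    then have "x = conjg G h (conjg G (inv h) n \<otimes> m)" using h m Nc by (simp add: conjg_mult_right)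
    moreover have "conjg G (inv h) n \<in> N" using normal_conjg_closed[OF N_normal] h n by simp
    ultimately show "x \<in> conjg G h ` (N #> m)" unfolding r_coset_def by auto
  qed
qed

lemma conjg_abelian_endo:
  assumes h: "h \<in> carrier G" and hM: "conjg G h ` M \<subseteq> M"
  shows "abelian_endo Q ((`) (conjg G h))"
proof -
  interpret Q: comm_group Q by (rule comm_group_Q)
  show ?thesis
  proof
    have hm: "conjg G h m \<in> M" if "m \<in> M" for m using that hM by blast
    show "(`) (conjg G h) \<in> hom Q Q"
    proof (rule homI)
      fix x assume "x \<in> carrier Q"
      then show "conjg G h ` x \<in> carrier Q" using h hm by (auto simp: carrier_Q conjg_image_coset)
    next
      fix x y assume "x \<in> carrier Q" "y \<in> carrier Q"
      then obtain a b where "a \<in> M" "b \<in> M" "x = N #> a" "y = N #> b" by (auto simp: carrier_Q)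
      then show "conjg G h ` (x \<otimes>\<^bsub>Q\<^esub> y) = conjg G h ` x \<otimes>\<^bsub>Q\<^esub> conjg G h ` y"
        using h hm subgroup.m_closed[OF M_subgroup]
        by (simp add: mult_Q conjg_image_coset conjg_mult_right)
    qed
  qed
qed

lemma conjg_inj:
  assumes h: "h \<in> carrier G"
  shows "inj_on ((`) (conjg G h)) (carrier Q)"
proof -
  have "inj_on (conjg G h) (carrier G)" by (rule inj_on_inverseI[of _ "conjg G (inv h)"]) (use h in simp)
  moreover have "carrier Q \<subseteq> Pow (carrier G)"
    unfolding carrier_Q
    by (intro image_subsetI PowI r_coset_subset_G subgroup.subset[OF N_subgroup] M_carrier)
  ultimately show ?thesis by (rule inj_on_subset[OF inj_on_image_Pow])
qed

lemma pact_in_M: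
  assumes "h \<in> carrier G" "conjg G h ` M \<subseteq> M" "m \<in> M"
  shows "pact G (conjg G h) p m \<in> M"
  using assms by (intro pact_closed M_subgroup) auto

lemma proj_pact:
  assumes h: "h \<in> carrier G" and hM: "conjg G h ` M \<subseteq> M" and m: "m \<in> M"
  shows "N #> pact G (conjg G h) p m = pact Q ((`) (conjg G h)) p (N #> m)"
  by (rule pact_hom_image[OF group_Q proj_hom M_subgroup]) (use assms in \<open>auto simp: conjg_image_coset\<close>)

text \<open>A subgroup containing \<open>N\<close> is a union of cosets of \<open>N\<close>. Hence
  computations in the module \<open>Q\<close> decide membership in a stabiliser, even if the
  stabiliser is neither normal nor invariant under conjugation.\<close>

lemma mem_cong_of_proj_eq:
  assumes "subgroup H G" "N \<subseteq> H" "a \<in> M" "b \<in> M" "N #> a = N #> b"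
  shows "a \<in> H \<longleftrightarrow> b \<in> H"
proof -
  have ab: "a \<otimes> inv b \<in> H" using assms proj_eq_iff by auto
  have "a = (a \<otimes> inv b) \<otimes> b" "b = inv (a \<otimes> inv b) \<otimes> a"
    using assms(3,4) by (simp_all add: m_assoc inv_mult_group)
  then show ?thesis using ab assms(1) by (metis subgroup.m_closed subgroup.m_inv_closed)
qed

end

lemma (in group) abelian_sectionI:
  assumes "N \<lhd> G" "subgroup M G" "N \<subseteq> M" "\<And>x y. x \<in> M \<Longrightarrow> y \<in> M \<Longrightarrow> commutator G x y \<in> N"
  shows "abelian_section G N M"
  by (intro abelian_section.intro abelian_section_axioms.intro is_group assms)

section \<open>Coset growth of a family of subgroups, and growth from expanding elements\<close>

primrec ball :: "('a, 'm) monoid_scheme \<Rightarrow> 'a set \<Rightarrow> nat \<Rightarrow> 'a set" where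
  "ball G T 0 = {\<one>\<^bsub>G\<^esub>}"
| "ball G T (Suc n) = {t \<otimes>\<^bsub>G\<^esub> u | t u. t \<in> T \<and> u \<in> ball G T n}"

text \<open>\<open>H\<close> may vary with \<open>n\<close>, just as the maximising point does in
  the growth of an action. The exponent \<open>d\<close> absorbs the number of generators in
  \<open>exp_growth_of_expanding\<close>; the condition amounts to at least \<open>2 ^ n\<close> to
  the power \<open>1 / d\<close> cosets.\<close>

definition exp_growth :: "('a, 'm) monoid_scheme \<Rightarrow> 'a set set \<Rightarrow> bool" where
  "exp_growth G \<H> \<longleftrightarrow> (\<exists>T L d. finite T \<and> T \<subseteq> carrier G \<and>
     (\<forall>n. \<exists>H\<in>\<H>. 2 ^ n \<le> card ((\<lambda>t. t <#\<^bsub>G\<^esub> H) ` ball G T (L * n)) ^ d))"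

context group
begin

lemma ball_carrier: "T \<subseteq> carrier G \<Longrightarrow> ball G T n \<subseteq> carrier G"
  by (induction n) auto

lemma finite_ball: "finite T \<Longrightarrow> finite (ball G T n)"
proof (induction n)
  case (Suc n)
  have "ball G T (Suc n) = (\<lambda>(t, u). t \<otimes> u) ` (T \<times> ball G T n)" by auto
  then show ?case using Suc by simp
qed simp

lemma ball_add:
  assumes "T \<subseteq> carrier G" "u \<in> ball G T m" "v \<in> ball G T n"
  shows "u \<otimes> v \<in> ball G T (m + n)"
  using assms(2)
proof (induction m arbitrary: u)
  case 0
  then show ?case using assms(3) ball_carrier[OF assms(1), of n] by auto
next
  case (Suc m)
  then obtain t u' where t: "u = t \<otimes> u'" "t \<in> T" "u' \<in> ball G T m" by auto
  then have "u \<otimes> v = t \<otimes> (u' \<otimes> v)" using assms(1,3) ball_carrier by (metis m_assoc subsetD)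
  then show ?case using Suc.IH[OF t(3)] t(2) by auto
qed

lemma ball_1: "T \<subseteq> carrier G \<Longrightarrow> ball G T (Suc 0) = T"
  by (force simp: subset_iff)

text \<open>\<open>ball\<close> collects products of exactly \<open>n\<close> factors; the identity
  as a letter pads shorter words.\<close>

lemma ball_mono:
  assumes "T \<subseteq> carrier G" "\<one> \<in> T" "m \<le> n"
  shows "ball G T m \<subseteq> ball G T n"
proof -
  have "ball G T m \<subseteq> ball G T (Suc m)" for m
    using assms(2) ball_carrier[OF assms(1), of m] by force
  then show ?thesis using assms(3) lift_Suc_mono_le[of "ball G T"] by blast
qed

text \<open>Horner form costs three letters per coefficient, namely \<open>s [^] c\<close>,
  \<open>h\<close> and \<open>inv h\<close>, so the length is linear in the degree, whereas
  conjugating each term separately would make it quadratic. The factor 4 leaves one letter to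
  spare.\<close>

lemma pact_01_in_ball:
  assumes T: "T \<subseteq> carrier G" "\<one> \<in> T" "h \<in> T" "inv h \<in> T" "s \<in> T"
    and cs: "set cs \<subseteq> {0, 1 :: int}"
  shows "foldr (\<lambda>c y. s [^] c \<otimes> conjg G h y) cs \<one> \<in> ball G T (4 * length cs)"
  using cs
proof (induction cs)
  case (Cons c cs)
  let ?y = "foldr (\<lambda>c y. s [^] c \<otimes> conjg G h y) cs \<one>"
  have y: "?y \<in> ball G T (4 * length cs)" using Cons by simp
  then have yc: "?y \<in> carrier G" using ball_carrier T by blast
  have [simp]: "s \<in> carrier G" "h \<in> carrier G" using T by auto
  have "s [^] c \<in> T" using Cons.prems T by auto
  then have "s [^] c \<otimes> (h \<otimes> (?y \<otimes> inv h)) \<in> ball G T (1 + (1 + (4 * length cs + 1)))"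
    using y T by (intro ball_add) (auto simp: ball_1 simp del: ball.simps(2))
  also have "\<dots> \<subseteq> ball G T (4 * length (c # cs))" by (intro ball_mono T) simp
  finally show ?case using yc by (simp add: conjg_def m_assoc)
qed simp

lemma coeff_sum_monom: "finite E \<Longrightarrow> coeff (\<Sum>i\<in>E. monom (1::int) i) j = (if j \<in> E then 1 else 0)"
  by (simp add: coeff_sum coeff_monom)

text \<open>If some \<open>H \<in> \<H>\<close> misses the image of \<open>w\<close> under the product of all unit polynomials of
  degree less than \<open>n\<close>, then none of these polynomials maps every generator of \<open>M\<close> into \<open>H\<close>.
  Hence the sums \<open>\<Sum>\<epsilon>\<^sub>i h\<^sup>i s\<close>, for \<open>s\<close> ranging over all generators simultaneously,
  separate the \<open>2\<^sup>n\<close> choices of \<open>\<epsilon> \<in> {0, 1}\<^sup>n\<close> modulo \<open>H\<close>.\<close>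

lemma exp_growth_of_expanding:
  assumes sec: "abelian_section G N M" and N: "N = \<Inter>\<H>" and \<H>: "\<And>H. H \<in> \<H> \<Longrightarrow> subgroup H G"
    and S: "finite S" "S \<subseteq> M" "generate G S = M"
    and h: "h \<in> carrier G" "conjg G h ` M \<subseteq> M" and w: "w \<in> M"
    and expanding: "\<And>F. finite F \<Longrightarrow> F \<subseteq> unit_polys \<Longrightarrow> pact G (conjg G h) (\<Prod>F) w \<notin> N"
  shows "exp_growth G \<H>"
proof -
  interpret abelian_section G N M by (rule sec)
  interpret Q: abelian_endo Q "(`) (conjg G h)" by (rule conjg_abelian_endo[OF h])
  let ?a = "pact G (conjg G h)" and ?q = "pact Q ((`) (conjg G h))"
  define T where "T = insert \<one> (insert h (insert (inv h) S))"
  have T: "finite T" "T \<subseteq> carrier G" using S h by (auto simp: T_def)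
  have "\<exists>H\<in>\<H>. 2 ^ n \<le> card ((\<lambda>t. t <# H) ` ball G T (4 * n)) ^ card S" for n
  proof -
    define F where "F = {f \<in> unit_polys. degree f < n}"
    have "F \<subseteq> {r. degree r \<le> n \<and> (\<forall>j. \<bar>coeff r j\<bar> \<le> 1)}"
    proof
      fix f assume f: "f \<in> F"
      have "\<bar>coeff f j\<bar> \<le> 1" for j
      proof -
        have "coeff f j \<in> {-1, 0, 1}" using f by (simp add: F_def unit_polys_def)
        then show ?thesis by auto
      qed
      then show "f \<in> {r. degree r \<le> n \<and> (\<forall>j. \<bar>coeff r j\<bar> \<le> 1)}" using f by (simp add: F_def)
    qed
    then have finF: "finite F" using finite_bounded_int_polys finite_subset by blast
    have "?a (\<Prod>F) w \<notin> N" using expanding[OF finF] by (auto simp: F_def)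
    then obtain H where H: "H \<in> \<H>" "?a (\<Prod>F) w \<notin> H" using N by blast
    note subH = \<H>[OF H(1)]
    have NH: "N \<subseteq> H" using N H by blast
    have separated: "\<exists>s\<in>S. ?a f s \<notin> H" if f: "f \<in> F" for f
    proof (rule ccontr)
      assume all: "\<not> (\<exists>s\<in>S. ?a f s \<notin> H)"
      \<comment> \<open>\<open>K\<close> is a subgroup because \<open>f\<close> acts additively
        modulo \<open>N\<close> and \<open>H\<close> contains \<open>N\<close>.\<close>
      define K where "K = {m \<in> M. ?a f m \<in> H}"
      have "subgroup K G"
      proof (rule subgroupI)
        have "?a f \<one> = \<one>" by (induction f) (use h in \<open>simp_all add: pact_pCons\<close>)
        then have "\<one> \<in> K" using subgroup.one_closed[OF subH] subgroup.one_closed[OF M_subgroup] by (simp add: K_def)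
        then show "K \<noteq> {}" by blast
      next
        fix x assume x: "x \<in> K"
        then have "inv x \<in> M" using M_subgroup by (simp add: K_def subgroup.m_inv_closed)
        moreover have "N #> ?a f (inv x) = N #> inv (?a f x)"
          using x h \<open>inv x \<in> M\<close> pact_in_M[OF h]
          by (simp add: K_def proj_pact inv_Q[symmetric] Q.pact_inv_elem carrier_Q)
        moreover have "inv (?a f x) \<in> M" "inv (?a f x) \<in> H" 
          using x pact_in_M[OF h, of x f] M_subgroup subH by (auto simp: K_def subgroup.m_inv_closed)
        ultimately show "inv x \<in> K"
          using mem_cong_of_proj_eq[OF subH NH, of "?a f (inv x)" "inv (?a f x)"] pact_in_M[OF h]
          by (simp add: K_def)
      next
        fix x y assume x: "x \<in> K" and y: "y \<in> K"
        then have "x \<otimes> y \<in> M" using M_subgroup by (simp add: K_def subgroup.m_closed)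
        moreover have "N #> ?a f (x \<otimes> y) = N #> (?a f x \<otimes> ?a f y)"
          using x y h \<open>x \<otimes> y \<in> M\<close> pact_in_M[OF h]
          by (simp add: K_def proj_pact mult_Q[symmetric] Q.pact_mult_elem carrier_Q)
        moreover have "?a f x \<otimes> ?a f y \<in> M" "?a f x \<otimes> ?a f y \<in> H" 
          using x y pact_in_M[OF h] M_subgroup subH by (auto simp: K_def subgroup.m_closed)
        ultimately show "x \<otimes> y \<in> K"
          using mem_cong_of_proj_eq[OF subH NH, of "?a f (x \<otimes> y)" "?a f x \<otimes> ?a f y"] pact_in_M[OF h]
          by (simp add: K_def)
      qed (simp add: K_def subset_iff)
      moreover have "S \<subseteq> K" using all S(2) by (auto simp: K_def)
      ultimately have "M \<subseteq> K" using generate_subgroup_incl S(3) by blast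
      \<comment> \<open>The product is \<open>f\<close> applied after its cofactor \<open>g\<close>.
        If \<open>f\<close> sent all of \<open>M\<close> into \<open>H\<close>, it would send the
        image of \<open>w\<close> under \<open>g\<close> there, contrary to the choice of
        \<open>H\<close>.\<close>
      define g where "g = \<Prod>(F - {f})"
      have fg: "\<Prod>F = f * g" unfolding g_def using finF f by (rule prod.remove)
      have gM: "?a g w \<in> M" using pact_in_M[OF h w] .
      have "N #> ?a (\<Prod>F) w = N #> ?a f (?a g w)"
        using proj_pact[OF h w, of "f * g"] proj_pact[OF h w, of g] proj_pact[OF h gM, of f] w
        by (simp add: fg Q.pact_mult carrier_Q)
      moreover have "?a f (?a g w) \<in> H" using gM \<open>M \<subseteq> K\<close> by (auto simp: K_def)
      ultimately have "?a (\<Prod>F) w \<in> H"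
        using mem_cong_of_proj_eq[OF subH NH] pact_in_M[OF h] w gM by blast
      then show False using H(2) by blast
    qed
    define p where "p E = (\<Sum>i\<in>E. monom (1::int) i)" for E :: "nat set"
    define Y where "Y = (\<lambda>t. t <# H) ` ball G T (4 * n)"
    define \<Psi> where "\<Psi> E = restrict (\<lambda>s. ?a (p E) s <# H) S" for E
    have finY: "finite Y" unfolding Y_def using finite_ball T by blast
    have "inj_on \<Psi> (Pow {..<n})"
    proof (rule inj_onI)
      fix E E' assume E: "E \<in> Pow {..<n}" "E' \<in> Pow {..<n}" and eq: "\<Psi> E = \<Psi> E'"
      have fin: "finite E" "finite E'" using E by (auto intro: finite_subset)
      define f where "f = p E' - p E"
      have cf: "coeff f j = (if j \<in> E' then 1 else 0) - (if j \<in> E then 1 else 0)" for j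
        using fin by (simp add: f_def p_def coeff_sum_monom)
      show "E = E'"
      proof (rule ccontr)
        assume "E \<noteq> E'"
        then obtain j where j: "j \<in> E \<longleftrightarrow> j \<notin> E'" by blast
        then have "f \<noteq> 0" using cf[of j] by auto
        moreover have "degree f < n"
        proof (rule degree_lessI)
          have "n > 0" using j E by auto
          then show "f \<noteq> 0 \<or> n > 0" by simp
          show "\<forall>k\<ge>n. coeff f k = 0" unfolding cf using E by auto
        qed
        ultimately have "f \<in> F" unfolding F_def unit_polys_def by (auto simp: cf)
        then obtain s where s: "s \<in> S" "?a f s \<notin> H" using separated by blast
        have sM: "s \<in> M" using s S by blast
        have aM: "?a q s \<in> M" for q using pact_in_M[OF h sM] .
        have "?a (p E) s <# H = ?a (p E') s <# H" using fun_cong[OF eq, of s] s(1) by (simp add: \<Psi>_def)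
        then have "inv (?a (p E) s) \<otimes> ?a (p E') s \<in> H" using lcos_eq_iff[OF subH] aM by simp
        moreover have "N #> s \<in> carrier Q" using sM by (simp add: carrier_Q)
        then have "N #> ?a f s = N #> (inv (?a (p E) s) \<otimes> ?a (p E') s)"
          using aM sM h M_subgroup
          by (simp add: f_def proj_pact Q.pact_diff mult_Q[symmetric] inv_Q[symmetric] subgroup.m_inv_closed Q.m_comm)
        moreover have "inv (?a (p E) s) \<otimes> ?a (p E') s \<in> M" using aM M_subgroup
          by (simp add: subgroup.m_inv_closed subgroup.m_closed)
        ultimately show False using s(2) mem_cong_of_proj_eq[OF subH NH aM[of f]] by blast
      qed
    qed
    moreover have "\<Psi> ` Pow {..<n} \<subseteq> (\<Pi>\<^sub>E s\<in>S. Y)"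
    proof
      fix z assume "z \<in> \<Psi> ` Pow {..<n}"
      then obtain E where E: "E \<subseteq> {..<n}" "z = \<Psi> E" by auto
      have "?a (p E) s <# H \<in> Y" if s: "s \<in> S" for s
      proof -
        have fin: "finite E" using E by (auto intro: finite_subset)
        have "set (coeffs (p E)) \<subseteq> {0, 1}"
        proof
          fix x assume "x \<in> set (coeffs (p E))"
          then obtain j where "x = coeff (p E) j" using range_coeff[of "p E"] by blast
          then show "x \<in> {0, 1}" using fin by (auto simp: p_def coeff_sum_monom)
        qed
        then have "?a (p E) s \<in> ball G T (4 * length (coeffs (p E)))"
          unfolding pact_def by (intro pact_01_in_ball) (use T s in \<open>auto simp: T_def\<close>)
        moreover have "length (coeffs (p E)) \<le> n"
        proof (cases "p E = 0")
          case False
          have "degree (p E) < n"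
          proof (rule degree_lessI)
            show "\<forall>k\<ge>n. coeff (p E) k = 0" using E fin by (auto simp: p_def coeff_sum_monom)
          qed (use False in simp)
          then show ?thesis using False by (simp add: length_coeffs_degree)
        qed simp
        then have "ball G T (4 * length (coeffs (p E))) \<subseteq> ball G T (4 * n)"
          by (intro ball_mono T) (auto simp: T_def)
        ultimately show ?thesis unfolding Y_def by blast
      qed
      then show "z \<in> (\<Pi>\<^sub>E s\<in>S. Y)" by (simp add: E(2) \<Psi>_def restrict_PiE_iff)
    qed
    moreover have "finite (\<Pi>\<^sub>E s\<in>S. Y)" by (intro finite_PiE S(1) finY)
    ultimately have "card (Pow {..<n}) \<le> card (\<Pi>\<^sub>E s\<in>S. Y)" by (rule card_inj_on_le)
    \<comment> \<open>Separating two subsets may take any of the generators, so \<open>Y\<close> is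
      counted once per generator; this is the origin of \<open>d\<close>.\<close>
    then have "2 ^ n \<le> card Y ^ card S" by (simp add: card_Pow card_PiE S(1))
    then show ?thesis using H(1) unfolding Y_def by blast
  qed
  then show ?thesis unfolding exp_growth_def using T by blast
qed

end

section \<open>Finite orbits on abelian sections of polycyclic groups\<close>

context group
begin

lemma polycyclic_seq_subgroup: "polycyclic_seq G H \<Longrightarrow> subgroup H G"
  by (induction rule: polycyclic_seq.induct) (auto simp: triv_subgroup)

lemma cyclic_extension:
  assumes K: "K \<lhd> G\<lparr>carrier := H\<rparr>" and H: "subgroup H G" and cyc: "cyclic_group ((G\<lparr>carrier := H\<rparr>) Mod K)"
  obtains t where "t \<in> H" "\<And>x. x \<in> H \<Longrightarrow> \<exists>k\<in>K. \<exists>i::int. x = k \<otimes> t [^] i"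
proof -
  interpret K: normal K "G\<lparr>carrier := H\<rparr>" by (rule K)
  let ?Q = "(G\<lparr>carrier := H\<rparr>) Mod K"
  have "group ?Q" by (rule K.factorgroup_is_group)
  then obtain \<tau> where \<tau>: "\<tau> \<in> carrier ?Q" "carrier ?Q = range (\<lambda>n::int. \<tau> [^]\<^bsub>?Q\<^esub> n)"
    using group.cyclic_group cyc by blast
  have "\<tau> \<in> (#>) K ` H" using \<tau>(1) by (simp add: carrier_FactGroup)
  then obtain t where t: "t \<in> H" "\<tau> = K #> t" by blast
  have "\<exists>k\<in>K. \<exists>i::int. x = k \<otimes> t [^] i" if x: "x \<in> H" for x
  proof -
    have "K #> x \<in> carrier ?Q" using x by (auto simp: carrier_FactGroup)
    then obtain i :: int where i: "K #> x = \<tau> [^]\<^bsub>?Q\<^esub> i" using \<tau>(2) by auto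
    have "\<tau> [^]\<^bsub>?Q\<^esub> i = K #> (t [^] i)"
      using K.FactGroup_int_pow[of t i] t int_pow_consistent[OF H t(1), of i] by simp
    moreover have "x \<in> K #> x"
      using rcos_self[OF _ incl_subgroup[OF H K.is_subgroup]] subgroup.mem_carrier[OF H x] by simp
    ultimately have "x \<in> K #> (t [^] i)" using i by simp
    then show ?thesis unfolding r_coset_def by auto
  qed
  then show ?thesis using that t(1) by blast
qed

text \<open>By induction \<open>L \<inter> K\<close> is finitely generated. The exponents of
  \<open>t\<close> occurring in \<open>L\<close> form a subgroup of the integers, so a single
  further element, with the least positive exponent, completes a generating set.\<close>

lemma polycyclic_seq_fin_gen:
  assumes "polycyclic_seq G H" "subgroup L G" "L \<subseteq> H"
  shows "\<exists>S. finite S \<and> S \<subseteq> L \<and> generate G S = L"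
  using assms
proof (induction arbitrary: L rule: polycyclic_seq.induct)
  case unity
  then have "L = {\<one>}" using subgroup.one_closed by blast
  then show ?case by (intro exI[of _ "{}"]) (simp add: generate_empty)
next
  case (extension K H)
  have subK: "subgroup K G" using extension.hyps(1) by (rule polycyclic_seq_subgroup)
  have subH: "subgroup H G" by fact
  have subL: "subgroup L G" by fact
  interpret K: normal K "G\<lparr>carrier := H\<rparr>" by fact
  have KH: "K \<subseteq> H" using K.subset by simp
  note Hc = subgroup.mem_carrier[OF subH]
  note Lc = subgroup.mem_carrier[OF subL]
  have conjK: "conjg G h k \<in> K" if "h \<in> H" "k \<in> K" for h k
    using K.inv_op_closed2[of h k] that m_inv_consistent[OF subH, of h] by (simp add: conjg_def)
  obtain t where t: "t \<in> H" "\<And>x. x \<in> H \<Longrightarrow> \<exists>k\<in>K. \<exists>i::int. x = k \<otimes> t [^] i"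
    using cyclic_extension[OF extension.hyps(2-4)] by blast
  have tc: "t \<in> carrier G" using Hc t(1) .
  have "subgroup (L \<inter> K) G" by (rule subgroups_Inter_pair[OF subL subK])
  then obtain S where S: "finite S" "S \<subseteq> L \<inter> K" "generate G S = L \<inter> K"
    using extension.IH[of "L \<inter> K"] by blast
  \<comment> \<open>The cyclic factor may be finite, so an element can have several exponents;
    \<open>ex\<close> collects all of them and is still closed under differences.\<close>
  define ex where "ex L' = {i::int. \<exists>k\<in>K. k \<otimes> t [^] i \<in> L'}" for L'
  have diff: "i - j \<in> ex L'" if L': "subgroup L' G" and ij: "i \<in> ex L'" "j \<in> ex L'" for i j L'
  proof -
    obtain k where k: "k \<in> K" "k \<otimes> t [^] i \<in> L'" using ij by (auto simp: ex_def)
    obtain k' where k': "k' \<in> K" "k' \<otimes> t [^] j \<in> L'" using ij by (auto simp: ex_def)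
    have kc: "k \<in> carrier G" "k' \<in> carrier G" using k(1) k'(1) subgroup.mem_carrier[OF subK] by auto
    have "(k \<otimes> t [^] i) \<otimes> inv (k' \<otimes> t [^] j) = (k \<otimes> conjg G (t [^] (i - j)) (inv k')) \<otimes> t [^] (i - j)"
      using kc tc by (simp add: conjg_def m_assoc inv_mult_group int_pow_diff)
    moreover have "k \<otimes> conjg G (t [^] (i - j)) (inv k') \<in> K"
      using k(1) k'(1) subK
      by (intro subgroup.m_closed[OF subK] conjK subgroup_int_pow_closed[OF subH t(1)] subgroup.m_inv_closed[OF subK])
    moreover have "(k \<otimes> t [^] i) \<otimes> inv (k' \<otimes> t [^] j) \<in> L'"
      by (rule subgroup.m_closed[OF L' k(2) subgroup.m_inv_closed[OF L' k'(2)]])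
    ultimately show ?thesis unfolding ex_def by auto
  qed
  have mult: "q * d \<in> ex L'" if L': "subgroup L' G" and d: "d \<in> ex L'" for q d L'
  proof -
    have 0: "0 \<in> ex L'" using diff[OF L' d d] by simp
    have neg: "- i \<in> ex L'" if "i \<in> ex L'" for i using diff[OF L' 0 that] by simp
    have *: "int n * d \<in> ex L'" for n
    proof (induction n)
      case (Suc n)
      then show ?case using diff[OF L' Suc neg[OF d]] by (simp add: algebra_simps)
    qed (simp add: 0)
    show ?thesis
    proof (cases "q \<ge> 0")
      case True then show ?thesis using *[of "nat q"] by simp
    next
      case False then show ?thesis using neg[OF *[of "nat (- q)"]] by simp
    qed
  qed
  show ?case
  proof (cases "ex L \<subseteq> {0}")
    case True
    have "L \<subseteq> K"
    proof
      fix l assume l: "l \<in> L"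
      then obtain k and i :: int where ki: "k \<in> K" "l = k \<otimes> t [^] i" using t(2) extension.prems(2) by blast
      then have "i \<in> ex L" using l by (auto simp: ex_def)
      then have "i = 0" using True by blast
      then show "l \<in> K" using ki subgroup.mem_carrier[OF subK] by simp
    qed
    then have "L \<inter> K = L" by blast
    then show ?thesis using S by auto
  next
    case False
    then obtain i where i: "i \<in> ex L" "i \<noteq> 0" by blast
    have "\<exists>n::nat. n > 0 \<and> int n \<in> ex L"
    proof (intro exI[of _ "nat \<bar>i\<bar>"] conjI)
      show "int (nat \<bar>i\<bar>) \<in> ex L" using i mult[OF subL i(1), of "-1"] by (cases "i \<ge> 0") auto
    qed (use i in auto)
    then have "\<exists>n::nat. (n > 0 \<and> int n \<in> ex L) \<and> (\<forall>m<n. \<not> (m > 0 \<and> int m \<in> ex L))"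
      by (rule exists_least_iff[THEN iffD1])
    then obtain d :: nat where d: "d > 0" "int d \<in> ex L" "\<And>m. m < d \<Longrightarrow> m > 0 \<Longrightarrow> int m \<notin> ex L" by blast
    \<comment> \<open>\<open>int d \<in> ex {l0}\<close> says that \<open>l0\<close> lies in the
      coset of \<open>K\<close> given by \<open>t [^] d\<close>.\<close>
    obtain l0 where l0: "l0 \<in> L" "int d \<in> ex {l0}" using d(2) by (auto simp: ex_def)
    define S' where "S' = insert l0 S"
    have S'L: "S' \<subseteq> L" using S l0 by (auto simp: S'_def)
    define L' where "L' = generate G S'"
    have S'c: "S' \<subseteq> carrier G" using S'L subgroup.subset[OF subL] by (rule subset_trans)
    have subL': "subgroup L' G" unfolding L'_def by (rule generate_is_subgroup[OF S'c])
    have L'L: "L' \<subseteq> L" unfolding L'_def by (rule generate_subgroup_incl[OF S'L subL])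
    have "generate G S \<subseteq> L'" unfolding L'_def S'_def by (rule mono_generate) auto
    then have LK: "L \<inter> K \<subseteq> L'" using S(3) by simp
    have "l0 \<in> L'" unfolding L'_def S'_def by (rule generate.incl) simp
    then have dL': "int d \<in> ex L'" using l0(2) by (auto simp: ex_def)
    have "L \<subseteq> L'"
    proof
      fix l assume l: "l \<in> L"
      then obtain k and i :: int where ki: "k \<in> K" "l = k \<otimes> t [^] i" using t(2) extension.prems(2) by blast
      then have iL: "i \<in> ex L" using l by (auto simp: ex_def)
      have "i - (i div int d) * int d \<in> ex L" by (rule diff[OF subL iL mult[OF subL d(2)]])
      then have "i mod int d \<in> ex L" by (simp add: minus_div_mult_eq_mod)
      moreover have "0 \<le> i mod int d" "i mod int d < int d" using d(1) by auto
      ultimately have "i mod int d = 0" using d(3)[of "nat (i mod int d)"] by (cases "i mod int d = 0") (auto simp: nat_less_iff)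
      then have i: "i = (i div int d) * int d" by auto
      have "i \<in> ex L'" by (subst i) (rule mult[OF subL' dL'])
      then obtain k' where k': "k' \<in> K" "k' \<otimes> t [^] i \<in> L'" by (auto simp: ex_def)
      define l' where "l' = k' \<otimes> t [^] i"
      have kc: "k \<in> carrier G" "k' \<in> carrier G" using ki(1) k'(1) subgroup.mem_carrier[OF subK] by auto
      \<comment> \<open>\<open>l\<close> and \<open>l'\<close> carry the same power of
        \<open>t\<close>, so their quotient falls into \<open>L \<inter> K\<close>, which
        \<open>L'\<close> contains.\<close>
      have "l \<otimes> inv l' = k \<otimes> inv k'" using kc tc by (simp add: ki(2) l'_def inv_mult_group m_assoc)
      moreover have "k \<otimes> inv k' \<in> K" by (rule subgroup.m_closed[OF subK ki(1) subgroup.m_inv_closed[OF subK k'(1)]])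
      moreover have "l \<otimes> inv l' \<in> L"
        using L'L k'(2) by (intro subgroup.m_closed[OF subL l] subgroup.m_inv_closed[OF subL]) (auto simp: l'_def)
      ultimately have "l \<otimes> inv l' \<in> L'" using LK by auto
      then have "(l \<otimes> inv l') \<otimes> l' \<in> L'" using k'(2) subgroup.m_closed[OF subL', of "l \<otimes> inv l'" l'] by (simp add: l'_def)
      moreover have "(l \<otimes> inv l') \<otimes> l' = l" using Lc[OF l] kc tc by (simp add: l'_def m_assoc)
      ultimately show "l \<in> L'" by simp
    qed
    then have "generate G S' = L" using L'L by (simp add: L'_def)
    then show ?thesis using S S'L by (intro exI[of _ S']) (simp add: S'_def)
  qed
qed

lemma polycyclic_imp_noetherian: "polycyclic_seq G (carrier G) \<Longrightarrow> noetherian_group G"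
  unfolding noetherian_group_def using polycyclic_seq_fin_gen subgroup.subset by metis

end

text \<open>Used to exchange the iterated action of \<open>t\<close> on cosets for the action of a
  power of \<open>t\<close>; agreement of the two is available only on the carrier of the
  quotient.\<close>

lemma (in comm_group) pact_cong:
  assumes "\<sigma> \<one> = \<one>" "\<And>x. x \<in> carrier G \<Longrightarrow> \<sigma> x = \<tau> x" "\<And>x. x \<in> carrier G \<Longrightarrow> \<sigma> x \<in> carrier G"
    and "w \<in> carrier G"
  shows "pact G \<sigma> p w = pact G \<tau> p w"
proof (induction p)
  case (pCons c p)
  have "\<tau> \<one> = \<one>" using assms(1) assms(2)[of \<one>] by simp
  moreover have "pact G \<sigma> p w \<in> carrier G"
    by (rule pact_closed) (use assms subgroup_self in auto)
  ultimately show ?case using pCons assms by (simp add: pact_pCons)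
qed simp

lemma (in abelian_section) funpow_conjg_coset:
  assumes h: "h \<in> carrier G" "conjg G h ` M \<subseteq> M" and m: "m \<in> M"
  shows "((`) (conjg G h) ^^ k) (N #> m) = N #> conjg G (h [^] k) m \<and> conjg G (h [^] k) m \<in> M"
proof (induction k)
  case 0
  then show ?case using m by simp
next
  case (Suc k)
  have "conjg G (h [^] Suc k) m = conjg G h (conjg G (h [^] k) m)"
    using h(1) m conjg_mult_left[of h "h [^] k" m] nat_pow_Suc2[of h k] by simp
  then show ?case using Suc h by (auto simp: conjg_image_coset)
qed

section \<open>Finite orbits on \<open>M/D\<close> and centralisers of finite index\<close>

definition coset_orbit :: "('a, 'm) monoid_scheme \<Rightarrow> 'a set \<Rightarrow> 'a set \<Rightarrow> 'a \<Rightarrow> 'a set set" where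
  "coset_orbit G D K m = (\<lambda>k. D #>\<^bsub>G\<^esub> conjg G k m) ` K"

definition centralizer_mod :: "('a, 'm) monoid_scheme \<Rightarrow> 'a set \<Rightarrow> 'a set \<Rightarrow> 'a set" where
  "centralizer_mod G D C = {g \<in> carrier G. \<forall>c\<in>C. commutator G g c \<in> D}"

locale normal_abelian_section = abelian_section G D M for G (structure) and D M +
  assumes M_normal: "M \<lhd> G"
begin

lemma conjg_M [simp]: "g \<in> carrier G \<Longrightarrow> m \<in> M \<Longrightarrow> conjg G g m \<in> M"
  by (rule normal_conjg_closed[OF M_normal])

lemma conjg_D [simp]: "g \<in> carrier G \<Longrightarrow> m \<in> D \<Longrightarrow> conjg G g m \<in> D"
  by (rule normal_conjg_closed[OF N_normal])

text \<open>The orbit of a product lies in the product of the two orbits, and the orbit of an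
  inverse consists of inverses.\<close>

lemma finite_orbit_subgroup:
  assumes K: "subgroup K G"
  shows "subgroup {m \<in> M. finite (coset_orbit G D K m)} G"
proof (rule subgroupI)
  note Kc = subgroup.mem_carrier[OF K]
  show "{m \<in> M. finite (coset_orbit G D K m)} \<subseteq> carrier G" by auto
  have "coset_orbit G D K \<one> \<subseteq> {D #> \<one>}" using Kc by (auto simp: coset_orbit_def)
  then have "finite (coset_orbit G D K \<one>)" using finite_subset by blast
  then show "{m \<in> M. finite (coset_orbit G D K m)} \<noteq> {}"
    using subgroup.one_closed[OF M_subgroup] by auto
next
  note Kc = subgroup.mem_carrier[OF K]
  fix a assume a: "a \<in> {m \<in> M. finite (coset_orbit G D K m)}"
  have "coset_orbit G D K (inv a) \<subseteq> m_inv Q ` coset_orbit G D K a"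
  proof
    fix x assume "x \<in> coset_orbit G D K (inv a)"
    then obtain k where k: "k \<in> K" "x = D #> conjg G k (inv a)" by (auto simp: coset_orbit_def)
    then have "x = inv\<^bsub>Q\<^esub> (D #> conjg G k a)" using a Kc by (simp add: inv_Q conjg_inv_right)
    then show "x \<in> m_inv Q ` coset_orbit G D K a" using k(1) by (auto simp: coset_orbit_def)
  qed
  moreover have "finite (coset_orbit G D K a)" using a by simp
  ultimately have "finite (coset_orbit G D K (inv a))" by (rule finite_surj[rotated])
  then show "inv a \<in> {m \<in> M. finite (coset_orbit G D K m)}"
    using a subgroup.m_inv_closed[OF M_subgroup] by simp
next
  note Kc = subgroup.mem_carrier[OF K]
  fix a b assume a: "a \<in> {m \<in> M. finite (coset_orbit G D K m)}" and b: "b \<in> {m \<in> M. finite (coset_orbit G D K m)}"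
  have "coset_orbit G D K (a \<otimes> b) \<subseteq> (\<lambda>(x, y). x \<otimes>\<^bsub>Q\<^esub> y) ` (coset_orbit G D K a \<times> coset_orbit G D K b)"
  proof
    fix x assume "x \<in> coset_orbit G D K (a \<otimes> b)"
    then obtain k where k: "k \<in> K" "x = D #> conjg G k (a \<otimes> b)" by (auto simp: coset_orbit_def)
    then have "x = (D #> conjg G k a) \<otimes>\<^bsub>Q\<^esub> (D #> conjg G k b)"
      using a b Kc by (simp add: mult_Q conjg_mult_right)
    then show "x \<in> (\<lambda>(x, y). x \<otimes>\<^bsub>Q\<^esub> y) ` (coset_orbit G D K a \<times> coset_orbit G D K b)"
      using k(1) by (auto simp: coset_orbit_def)
  qed
  moreover have "finite (coset_orbit G D K a \<times> coset_orbit G D K b)" using a b by simp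
  ultimately have "finite (coset_orbit G D K (a \<otimes> b))" by (rule finite_surj[rotated])
  then show "a \<otimes> b \<in> {m \<in> M. finite (coset_orbit G D K m)}"
    using a b subgroup.m_closed[OF M_subgroup] by simp
qed

lemma finite_orbit_of_mem_D:
  assumes "K \<subseteq> carrier G" "m \<in> D"
  shows "finite (coset_orbit G D K m)"
proof -
  have "D #> conjg G k m = D" if "k \<in> K" for k
    using assms that N_le_M conjg_D[of k m] by (subst proj_eq_one_iff) (auto simp del: conjg_D)
  then have "coset_orbit G D K m \<subseteq> {D}" by (auto simp: coset_orbit_def)
  then show ?thesis using finite_subset by blast
qed

text \<open>Moving \<open>h\<close> past an element of \<open>K\<close> only replaces that element
  by a conjugate in \<open>K\<close>, so conjugation by \<open>h\<close> maps the orbit of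
  \<open>m\<close> onto a set containing the orbit of its conjugate.\<close>

lemma finite_orbit_conjg:
  assumes K: "subgroup K G" and h: "h \<in> carrier G" "\<And>k. k \<in> K \<Longrightarrow> conjg G (inv h) k \<in> K"
    and m: "m \<in> M" "finite (coset_orbit G D K m)"
  shows "finite (coset_orbit G D K (conjg G h m))"
proof -
  note Kc = subgroup.mem_carrier[OF K]
  have "coset_orbit G D K (conjg G h m) \<subseteq> (`) (conjg G h) ` coset_orbit G D K m"
  proof
    fix x assume "x \<in> coset_orbit G D K (conjg G h m)"
    then obtain k where k: "k \<in> K" "x = D #> conjg G k (conjg G h m)" by (auto simp: coset_orbit_def)
    have "conjg G k (conjg G h m) = conjg G h (conjg G (conjg G (inv h) k) m)"
      using Kc[OF k(1)] h(1) m(1) by (simp add: conjg_def m_assoc inv_mult_group)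
    then have "x = conjg G h ` (D #> conjg G (conjg G (inv h) k) m)"
      using k h m(1) Kc by (simp add: conjg_image_coset)
    then show "x \<in> (`) (conjg G h) ` coset_orbit G D K m" using h(2)[OF k(1)] by (auto simp: coset_orbit_def)
  qed
  then show ?thesis by (rule finite_surj[OF m(2)])
qed


text \<open>Periodicity reduces the powers of \<open>t\<close> to exponents below \<open>n\<close>,
  so the orbit under \<open>H\<close> is covered by \<open>n\<close> orbits under \<open>K\<close>,
  each finite because \<open>t\<close> normalises \<open>K\<close>.\<close>

lemma finite_orbit_cyclic_extension:
  assumes K: "subgroup K G" and t: "t \<in> carrier G" "\<And>k. k \<in> K \<Longrightarrow> conjg G t k \<in> K" "\<And>k. k \<in> K \<Longrightarrow> conjg G (inv t) k \<in> K"
    and H: "\<And>x. x \<in> H \<Longrightarrow> \<exists>k\<in>K. \<exists>i::int. x = k \<otimes> t [^] i"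
    and w: "w \<in> M" "finite (coset_orbit G D K w)"
    and period: "n > 0" "D #> conjg G (t [^] (n::nat)) w = D #> w"
  shows "finite (coset_orbit G D H w)"
proof -
  note Kc = subgroup.mem_carrier[OF K]
  define a where "a i = conjg G (t [^] (i::int)) w" for i
  have aM: "a i \<in> M" for i using t(1) w(1) by (simp add: a_def)
  have shift: "D #> a (i + int n) = D #> a i" for i
  proof -
    have "a (i + int n) = conjg G (t [^] i) (conjg G (t [^] n) w)"
      using t(1) w(1) by (simp add: a_def int_pow_mult conjg_mult_left int_pow_int)
    then have "D #> a (i + int n) = conjg G (t [^] i) ` (D #> conjg G (t [^] n) w)"
      using t(1) w(1) by (simp add: conjg_image_coset)
    then show ?thesis using period(2) t(1) w(1) by (simp add: conjg_image_coset a_def)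
  qed
  have shift_nat: "D #> a (i + int q * int n) = D #> a i" for i q
  proof (induction q)
    case (Suc q)
    then show ?case using shift[of "i + int q * int n"] by (simp add: algebra_simps)
  qed simp
  have mod: "D #> a i = D #> a (i mod int n)" for i
  proof (cases "i div int n \<ge> 0")
    case True
    then show ?thesis using shift_nat[of "i mod int n" "nat (i div int n)"] by simp
  next
    case False
    then show ?thesis using shift_nat[of i "nat (- (i div int n))"] by (simp add: minus_div_mult_eq_mod)
  qed
  have fin: "finite (coset_orbit G D K (a (int r)))" for r
  proof (induction r)
    case 0
    then show ?case using w by (simp add: a_def)
  next
    case (Suc r)
    have "a (int (Suc r)) = conjg G t (a (int r))"
      using t(1) w(1) conjg_mult_left[of t "t [^] r" w] nat_pow_Suc2[of t r] by (simp add: a_def int_pow_int flip: of_nat_Suc)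
    then show ?case using finite_orbit_conjg[OF K t(1,3) aM Suc] by simp
  qed
  have "coset_orbit G D H w \<subseteq> (\<Union>r<n. coset_orbit G D K (a (int r)))"
  proof
    fix x assume "x \<in> coset_orbit G D H w"
    then obtain y where "y \<in> H" "x = D #> conjg G y w" by (auto simp: coset_orbit_def)
    with H obtain k and i :: int where k: "k \<in> K" "x = D #> conjg G (k \<otimes> t [^] i) w" by blast
    define r where "r = nat (i mod int n)"
    have r: "int r = i mod int n" "r < n" using period(1) by (auto simp: r_def nat_less_iff)
    have "x = conjg G k ` (D #> a i)"
      using k Kc t(1) w(1) by (simp add: a_def conjg_mult_left conjg_image_coset)
    also have "\<dots> = D #> conjg G k (a (int r))"
      using k Kc aM mod[of i] r by (simp add: conjg_image_coset)
    finally show "x \<in> (\<Union>r<n. coset_orbit G D K (a (int r)))" using k(1) r(2) by (auto simp: coset_orbit_def)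
  qed
  then show ?thesis using fin by (auto intro: finite_subset)
qed

text \<open>The elements with finite orbit under \<open>K\<close> form a section \<open>W/D\<close>,
  nontrivial by induction and invariant under \<open>t\<close>. The dichotomy for \<open>t\<close>
  on it gives either a periodic class, whose orbit under \<open>H\<close> is then finite, or an
  expanding element, which contradicts the assumption on growth.\<close>

lemma ex_finite_orbit:
  assumes "polycyclic_seq G K" and noeth: "noetherian_group G" and DM: "D \<noteq> M"
    and \<H>: "\<And>H. H \<in> \<H> \<Longrightarrow> subgroup H G" "\<not> exp_growth G \<H>"
    and N: "N \<lhd> G" "N = \<Inter>\<H>" "N \<subseteq> D" "\<And>x y. x \<in> M \<Longrightarrow> y \<in> M \<Longrightarrow> commutator G x y \<in> N"
  shows "\<exists>m\<in>M - D. finite (coset_orbit G D K m)"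
  using assms(1)
proof (induction rule: polycyclic_seq.induct)
  case unity
  obtain m where "m \<in> M - D" using DM N_le_M by blast
  then show ?case by (auto simp: coset_orbit_def)
next
  case (extension K H)
  then obtain m where m: "m \<in> M - D" "finite (coset_orbit G D K m)" by blast
  have subK: "subgroup K G" using extension.hyps(1) by (rule polycyclic_seq_subgroup)
  have subH: "subgroup H G" by fact
  interpret K: normal K "G\<lparr>carrier := H\<rparr>" by fact
  note Hc = subgroup.mem_carrier[OF subH]
  have conjK: "conjg G h k \<in> K" if "h \<in> H" "k \<in> K" for h k
    using K.inv_op_closed2[of h k] that m_inv_consistent[OF subH, of h] by (simp add: conjg_def)
  obtain t where t: "t \<in> H" "\<And>x. x \<in> H \<Longrightarrow> \<exists>k\<in>K. \<exists>i::int. x = k \<otimes> t [^] i"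
    using cyclic_extension[OF extension.hyps(2-4)] by blast
  have tc: "t \<in> carrier G" using Hc t(1) .
  have tH: "inv t \<in> H" using subgroup.m_inv_closed[OF subH t(1)] .
  define W where "W = {m \<in> M. finite (coset_orbit G D K m)}"
  have subW: "subgroup W G" unfolding W_def by (rule finite_orbit_subgroup[OF subK])
  have WM: "W \<subseteq> M" by (auto simp: W_def)
  have DW: "D \<subseteq> W" using N_le_M finite_orbit_of_mem_D[OF subgroup.subset[OF subK]] by (auto simp: W_def)
  have conjW: "conjg G t ` W \<subseteq> W"
    using finite_orbit_conjg[OF subK tc conjK[OF tH]] tc by (auto simp: W_def)
  have comW: "commutator G x y \<in> N" if "x \<in> W" "y \<in> W" for x y using that WM N(4) by blast
  interpret W: abelian_section G D W
    using abelian_sectionI[OF N_normal subW DW] comW N(3) by blast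
  have endo: "abelian_endo W.Q ((`) (conjg G t))" by (rule W.conjg_abelian_endo[OF tc conjW])
  have mW: "m \<in> W" using m by (simp add: W_def)
  have "D #> m \<noteq> D" using W.proj_eq_one_iff[OF mW] m by simp
  then have nontriv: "carrier W.Q \<noteq> {\<one>\<^bsub>W.Q\<^esub>}" using mW by (auto simp: W.carrier_Q W.one_Q)
  from abelian_endo.periodic_or_expanding[OF endo W.conjg_inj[OF tc] W.noetherian_Q[OF noeth] nontriv]
  show ?case
  proof (elim disjE bexE exE conjE)
    fix v n assume v: "v \<in> carrier W.Q" "v \<noteq> \<one>\<^bsub>W.Q\<^esub>" "n > 0" "((`) (conjg G t) ^^ n) v = v"
    obtain w where w: "w \<in> W" "v = D #> w" using v(1) unfolding W.carrier_Q by (auto simp only: image_iff)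
    have periodic: "w \<in> W" "D #> w \<noteq> D" "n > 0" "((`) (conjg G t) ^^ n) (D #> w) = D #> w"
      using v w by (simp_all add: W.one_Q)
    have fix_w: "D #> conjg G (t [^] n) w = D #> w"
      using W.funpow_conjg_coset[OF tc conjW periodic(1), of n] periodic(4) by simp
    have wM: "w \<in> M" "finite (coset_orbit G D K w)" using periodic(1) by (simp_all add: W_def)
    have "finite (coset_orbit G D H w)"
      by (rule finite_orbit_cyclic_extension[OF subK tc conjK[OF t(1)] conjK[OF tH] t(2) wM periodic(3) fix_w])
    moreover have "w \<in> M - D" using periodic(1,2) WM W.proj_eq_one_iff[OF periodic(1)] by auto
    ultimately show "\<exists>m\<in>M - D. finite (coset_orbit G D H m)" by (rule bexI)
  next
    fix v n assume v: "v \<in> carrier W.Q"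
      "\<forall>F. finite F \<and> F \<subseteq> unit_polys \<longrightarrow> pact W.Q ((`) (conjg G t) ^^ n) (\<Prod>F) v \<noteq> \<one>\<^bsub>W.Q\<^esub>"
    obtain w where w: "w \<in> W" "v = D #> w" using v(1) unfolding W.carrier_Q by (auto simp only: image_iff)
    note expanding = w(1) v(2)[unfolded w(2) W.one_Q]
    let ?h = "t [^] n"
    have hc: "?h \<in> carrier G" using tc by simp
    have conjh: "conjg G ?h ` W \<subseteq> W" using W.funpow_conjg_coset[OF tc conjW] by blast
    obtain S where S: "finite S" "S \<subseteq> W" "generate G S = W"
      using noeth subW unfolding noetherian_group_def by meson
    interpret Q: comm_group W.Q by (rule W.comm_group_Q)
    have endo_n: "abelian_endo W.Q ((`) (conjg G t) ^^ n)" by (rule abelian_endo.endo_funpow[OF endo])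
    \<comment> \<open>The expanding element was found in \<open>W/D\<close>, but growth is counted
      modulo \<open>N\<close>. As \<open>N \<subseteq> D\<close>, nonvanishing modulo
      \<open>D\<close> is the stronger statement, and \<open>W\<close> is abelian modulo
      \<open>N\<close> as well.\<close>
    have "pact G (conjg G ?h) (\<Prod>F) w \<notin> N" if F: "finite F" "F \<subseteq> unit_polys" for F
    proof
      assume "pact G (conjg G ?h) (\<Prod>F) w \<in> N"
      then have "D #> pact G (conjg G ?h) (\<Prod>F) w = D"
        using N(3) W.pact_in_M[OF hc conjh expanding(1)] W.proj_eq_one_iff by blast
      then have "pact W.Q ((`) (conjg G ?h)) (\<Prod>F) (D #> w) = D"
        using W.proj_pact[OF hc conjh expanding(1)] by simp
      moreover have "pact W.Q ((`) (conjg G t) ^^ n) (\<Prod>F) (D #> w) = pact W.Q ((`) (conjg G ?h)) (\<Prod>F) (D #> w)"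
      proof (rule Q.pact_cong)
        show "((`) (conjg G t) ^^ n) \<one>\<^bsub>W.Q\<^esub> = \<one>\<^bsub>W.Q\<^esub>" by (rule abelian_endo.endo_one[OF endo_n])
        show "((`) (conjg G t) ^^ n) x \<in> carrier W.Q" if "x \<in> carrier W.Q" for x
          using that by (rule abelian_endo.endo_closed[OF endo_n])
        show "((`) (conjg G t) ^^ n) x = conjg G ?h ` x" if x: "x \<in> carrier W.Q" for x
        proof -
          obtain v where v: "v \<in> W" "x = D #> v" using x unfolding W.carrier_Q by blast
          then show ?thesis
            using W.funpow_conjg_coset[OF tc conjW v(1)] W.conjg_image_coset[OF hc v(1)] by simp
        qed
        show "D #> w \<in> carrier W.Q" using expanding(1) by (simp add: W.carrier_Q)
      qed
      ultimately show False using expanding(2) F by simp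
    qed
    moreover have "abelian_section G N W"
      by (rule abelian_sectionI[OF N(1) subW subset_trans[OF N(3) DW] comW])
    ultimately have "exp_growth G \<H>"
      using exp_growth_of_expanding[OF _ N(2) \<H>(1) S hc conjh expanding(1)] by blast
    then show "\<exists>m\<in>M - D. finite (coset_orbit G D H m)" using \<H>(2) by contradiction
  qed
qed

end

lemma (in group) finite_rcosetsI:
  assumes Z: "subgroup Z G" and fin: "finite (f ` carrier G)"
    and f: "\<And>x y. x \<in> carrier G \<Longrightarrow> y \<in> carrier G \<Longrightarrow> f x = f y \<Longrightarrow> x \<otimes> inv y \<in> Z"
  shows "finite (rcosets Z)"
proof -
  define g where "g v = Z #> (SOME x. x \<in> carrier G \<and> f x = v)" for v
  have "rcosets Z \<subseteq> g ` f ` carrier G"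
  proof
    fix R assume "R \<in> rcosets Z"
    then obtain x where x: "x \<in> carrier G" "R = Z #> x" by (auto simp: RCOSETS_def)
    define y where "y = (SOME y. y \<in> carrier G \<and> f y = f x)"
    have y: "y \<in> carrier G \<and> f y = f x" unfolding y_def by (rule someI[of _ x]) (simp add: x(1))
    then have "Z #> x = Z #> y" using x(1) f[of x y] by (subst rcos_eq_iff[OF Z]) auto
    then have "R = g (f x)" by (simp add: g_def x(2) y_def)
    then show "R \<in> g ` f ` carrier G" using x(1) by blast
  qed
  then show ?thesis using fin finite_subset by blast
qed

context group
begin

lemma commutator_conv_conjg: "g \<in> carrier G \<Longrightarrow> c \<in> carrier G \<Longrightarrow> commutator G g c = conjg G g c \<otimes> inv c"
  by (simp add: commutator_def conjg_def)

lemma inv_commutator: "g \<in> carrier G \<Longrightarrow> c \<in> carrier G \<Longrightarrow> inv (commutator G g c) = commutator G c g"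
  by (simp add: commutator_def inv_mult_group m_assoc)

lemma conjg_commutator:
  "x \<in> carrier G \<Longrightarrow> a \<in> carrier G \<Longrightarrow> b \<in> carrier G \<Longrightarrow>
    conjg G x (commutator G a b) = commutator G (conjg G x a) (conjg G x b)"
  by (simp add: commutator_def conjg_mult_right conjg_inv_right)

lemma centralizer_mod_normal:
  assumes D: "D \<lhd> G" and C: "C \<lhd> G"
  shows "centralizer_mod G D C \<lhd> G"
proof -
  have subD: "subgroup D G" by (rule normal_imp_subgroup[OF D])
  have Cc: "c \<in> carrier G" if "c \<in> C" for c
    using that by (rule subgroup.mem_carrier[OF normal_imp_subgroup[OF C]])
  have conjC: "conjg G g c \<in> C" if "g \<in> carrier G" "c \<in> C" for g c
    using that by (rule normal_conjg_closed[OF C])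
  define Z where "Z = centralizer_mod G D C"
  have Z: "g \<in> Z \<longleftrightarrow> g \<in> carrier G \<and> (\<forall>c\<in>C. D #> conjg G g c = D #> c)" for g
  proof -
    have "commutator G g c \<in> D \<longleftrightarrow> D #> conjg G g c = D #> c" if "g \<in> carrier G" "c \<in> C" for c
      using that Cc by (simp add: rcos_eq_iff[OF subD] commutator_conv_conjg)
    then show ?thesis unfolding Z_def centralizer_mod_def by blast
  qed
  have "subgroup Z G"
  proof (rule subgroupI)
    show "Z \<subseteq> carrier G" by (auto simp: Z)
    have "\<one> \<in> Z" using Cc by (simp add: Z)
    then show "Z \<noteq> {}" by blast
  next
    fix a assume a: "a \<in> Z"
    have "D #> conjg G (inv a) c = D #> c" if c: "c \<in> C" for c
    proof -
      have "conjg G (inv a) c \<in> C" using a c conjC by (simp add: Z)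
      then have "D #> conjg G a (conjg G (inv a) c) = D #> conjg G (inv a) c" using a by (simp add: Z)
      then show ?thesis using a Cc[OF c] by (simp add: Z)
    qed
    then show "inv a \<in> Z" using a by (simp add: Z)
  next
    fix a b assume a: "a \<in> Z" and b: "b \<in> Z"
    have "D #> conjg G (a \<otimes> b) c = D #> c" if c: "c \<in> C" for c
      using a b conjC[OF _ c] Cc[OF c] c by (simp add: Z conjg_mult_left)
    then show "a \<otimes> b \<in> Z" using a b by (simp add: Z)
  qed
  moreover have "conjg G x g \<in> Z" if x: "x \<in> carrier G" and g: "g \<in> Z" for x g
  proof -
    have gc: "g \<in> carrier G" "\<And>c. c \<in> C \<Longrightarrow> commutator G g c \<in> D" using g by (auto simp: Z_def centralizer_mod_def)
    have "commutator G (conjg G x g) c \<in> D" if c: "c \<in> C" for c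
    proof -
      have "commutator G (conjg G x g) c = conjg G x (commutator G g (conjg G (inv x) c))"
        using x gc(1) Cc[OF c] by (simp add: conjg_commutator)
      then show ?thesis using x gc(2)[OF conjC[OF _ c]] normal_conjg_closed[OF D] by simp
    qed
    then show ?thesis using x gc(1) by (simp add: Z_def centralizer_mod_def)
  qed
  ultimately show ?thesis unfolding Z_def[symmetric] by (rule normalI_conjg)
qed

end

context normal_abelian_section
begin

text \<open>\<open>C\<close> consists of the elements whose class has a finite orbit under all of
  \<open>G\<close>. Finitely many generators have only finitely many possible images, so the
  elements acting trivially on \<open>C/D\<close> have finite index.\<close>

lemma ex_centralized_extension:
  assumes pc: "polycyclic_seq G (carrier G)" and DM: "D \<noteq> M"
    and \<H>: "\<And>H. H \<in> \<H> \<Longrightarrow> subgroup H G" "\<not> exp_growth G \<H>"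
    and N: "N \<lhd> G" "N = \<Inter>\<H>" "N \<subseteq> D" "\<And>x y. x \<in> M \<Longrightarrow> y \<in> M \<Longrightarrow> commutator G x y \<in> N"
  shows "\<exists>C. C \<lhd> G \<and> D \<subset> C \<and> C \<subseteq> M \<and> finite (rcosets (centralizer_mod G D C))"
proof (intro exI conjI)
  have noeth: "noetherian_group G" using pc by (rule polycyclic_imp_noetherian)
  define C where "C = {m \<in> M. finite (coset_orbit G D (carrier G) m)}"
  have subC: "subgroup C G" unfolding C_def by (rule finite_orbit_subgroup[OF subgroup_self])
  show normC: "C \<lhd> G"
    using finite_orbit_conjg[OF subgroup_self] by (intro normalI_conjg[OF subC]) (auto simp: C_def)
  show CM: "C \<subseteq> M" by (auto simp: C_def)
  have "D \<subseteq> C" using N_le_M finite_orbit_of_mem_D[of "carrier G"] by (auto simp: C_def)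
  moreover obtain m where "m \<in> M - D" "finite (coset_orbit G D (carrier G) m)"
    using ex_finite_orbit[OF pc noeth DM \<H> N] by blast
  ultimately show "D \<subset> C" by (auto simp: C_def)
  obtain S where S: "finite S" "S \<subseteq> C" "generate G S = C"
    using noeth subC unfolding noetherian_group_def by meson
  \<comment> \<open>The inverse makes the fibres of \<open>f\<close> lie in right cosets:
    \<open>f x = f y\<close> gives that \<open>x \<otimes> inv y\<close> acts trivially.\<close>
  define f where "f x = restrict (\<lambda>s. D #> conjg G (inv x) s) S" for x
  show "finite (rcosets (centralizer_mod G D C))"
  proof (rule finite_rcosetsI)
    show "subgroup (centralizer_mod G D C) G"
      by (rule normal_imp_subgroup[OF centralizer_mod_normal[OF N_normal normC]])
    have "f ` carrier G \<subseteq> (\<Pi>\<^sub>E s\<in>S. coset_orbit G D (carrier G) s)"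
      by (auto simp: f_def coset_orbit_def)
    moreover have "finite (\<Pi>\<^sub>E s\<in>S. coset_orbit G D (carrier G) s)"
      using S by (intro finite_PiE) (auto simp: C_def)
    ultimately show "finite (f ` carrier G)" by (rule finite_subset)
  next
    fix x y assume x: "x \<in> carrier G" and y: "y \<in> carrier G" and eq: "f x = f y"
    define E where "E = {c \<in> C. D #> conjg G (inv x) c = D #> conjg G (inv y) c}"
    have "subgroup E G"
    proof (rule subgroupI)
      show "E \<subseteq> carrier G" using CM by (auto simp: E_def)
      have "\<one> \<in> E" using subgroup.one_closed[OF subC] x y by (simp add: E_def)
      then show "E \<noteq> {}" by blast
    next
      fix a assume a: "a \<in> E"
      then have aM: "a \<in> M" using CM by (auto simp: E_def)
      have "D #> conjg G (inv x) (inv a) = inv\<^bsub>Q\<^esub> (D #> conjg G (inv x) a)"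
        "D #> conjg G (inv y) (inv a) = inv\<^bsub>Q\<^esub> (D #> conjg G (inv y) a)"
        using x y aM by (simp_all add: inv_Q conjg_inv_right)
      then show "inv a \<in> E" using a subgroup.m_inv_closed[OF subC] by (simp add: E_def)
    next
      fix a b assume a: "a \<in> E" and b: "b \<in> E"
      then have aM: "a \<in> M" "b \<in> M" using CM by (auto simp: E_def)
      have "D #> conjg G (inv x) (a \<otimes> b) = (D #> conjg G (inv x) a) \<otimes>\<^bsub>Q\<^esub> (D #> conjg G (inv x) b)"
        "D #> conjg G (inv y) (a \<otimes> b) = (D #> conjg G (inv y) a) \<otimes>\<^bsub>Q\<^esub> (D #> conjg G (inv y) b)"
        using x y aM by (simp_all add: mult_Q conjg_mult_right)
      then show "a \<otimes> b \<in> E" using a b subgroup.m_closed[OF subC] by (simp add: E_def)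
    qed
    moreover have "S \<subseteq> E"
    proof
      fix s assume s: "s \<in> S"
      have "D #> conjg G (inv x) s = D #> conjg G (inv y) s"
        using fun_cong[OF eq, of s] s by (simp add: f_def)
      then show "s \<in> E" using s S(2) by (auto simp: E_def)
    qed
    ultimately have CE: "C \<subseteq> E" using generate_subgroup_incl[of S E] S(3) by simp
    have "commutator G (x \<otimes> inv y) c \<in> D" if c: "c \<in> C" for c
    proof -
      have cM: "c \<in> M" using c CM by blast
      have "D #> conjg G (inv x) c = D #> conjg G (inv y) c" using c CE by (auto simp: E_def)
      then have "conjg G x ` (D #> conjg G (inv x) c) = conjg G x ` (D #> conjg G (inv y) c)" by simp
      then have "D #> c = D #> conjg G (x \<otimes> inv y) c"
        using x y cM by (simp add: conjg_image_coset conjg_mult_left)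
      then have "conjg G (x \<otimes> inv y) c \<otimes> inv c \<in> D" using x y cM by (simp add: proj_eq_iff[symmetric])
      then show ?thesis using x y cM by (simp add: commutator_conv_conjg)
    qed
    then show "x \<otimes> inv y \<in> centralizer_mod G D C" using x y by (simp add: centralizer_mod_def)
  qed
qed

end

section \<open>Virtual nilpotency modulo a normal subgroup\<close>

text \<open>For normal \<open>N\<close> this expresses that \<open>G/N\<close> is virtually
  nilpotent; phrasing it inside \<open>G\<close> allows \<open>N\<close> to vary in an induction
  without changing the group.\<close>

definition virtually_nilpotent_mod :: "('a, 'm) monoid_scheme \<Rightarrow> 'a set \<Rightarrow> bool" where
  "virtually_nilpotent_mod G N \<longleftrightarrow>
     (\<exists>H. subgroup H G \<and> finite (rcosets\<^bsub>G\<^esub> H) \<and> (\<exists>n. lower_central (G\<lparr>carrier := H\<rparr>) n \<subseteq> N))"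

context group
begin

lemma lower_central_subset:
  assumes H: "subgroup H G"
  shows "lower_central (G\<lparr>carrier := H\<rparr>) n \<subseteq> H"
proof -
  interpret H: group "G\<lparr>carrier := H\<rparr>" by (rule subgroup_imp_group[OF H])
  show ?thesis
  proof (induction n)
    case (Suc n)
    have "lower_central (G\<lparr>carrier := H\<rparr>) (Suc n) \<subseteq> carrier (G\<lparr>carrier := H\<rparr>)"
      unfolding lower_central.simps
      by (rule H.generate_incl) (use Suc in \<open>auto intro!: subgroup.m_closed[OF H] subgroup.m_inv_closed[OF H] simp: m_inv_consistent[OF H]\<close>)
    then show ?case by simp
  qed simp
qed

lemma lower_central_Suc_eq:
  assumes H: "subgroup H G"
  shows "lower_central (G\<lparr>carrier := H\<rparr>) (Suc n) =
    generate G {commutator G x y | x y. x \<in> lower_central (G\<lparr>carrier := H\<rparr>) n \<and> y \<in> H}"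
proof -
  let ?L = "G\<lparr>carrier := H\<rparr>"
  have eq: "{x \<otimes>\<^bsub>?L\<^esub> y \<otimes>\<^bsub>?L\<^esub> inv\<^bsub>?L\<^esub> x \<otimes>\<^bsub>?L\<^esub> inv\<^bsub>?L\<^esub> y | x y. x \<in> lower_central ?L n \<and> y \<in> carrier ?L} =
    {commutator G x y | x y. x \<in> lower_central ?L n \<and> y \<in> H}" (is "?A = ?B")
  proof -
    have "x \<otimes>\<^bsub>?L\<^esub> y \<otimes>\<^bsub>?L\<^esub> inv\<^bsub>?L\<^esub> x \<otimes>\<^bsub>?L\<^esub> inv\<^bsub>?L\<^esub> y = commutator G x y"
      if "x \<in> lower_central ?L n \<and> y \<in> carrier ?L" for x y
      using that lower_central_subset[OF H, of n] m_inv_consistent[OF H, of x] m_inv_consistent[OF H, of y]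
      by (auto simp: commutator_def)
    then have "?A = {commutator G x y | x y. x \<in> lower_central ?L n \<and> y \<in> carrier ?L}"
      by (intro Collect_cong ex_cong1) auto
    then show ?thesis by simp
  qed
  have sub: "?B \<subseteq> H"
    using lower_central_subset[OF H, of n]
    by (auto simp: commutator_def intro!: subgroup.m_closed[OF H] subgroup.m_inv_closed[OF H])
  show ?thesis unfolding lower_central.simps eq by (rule generate_consistent[OF sub H])
qed

lemma lower_central_mono:
  assumes "subgroup H G" "subgroup K G" "H \<subseteq> K"
  shows "lower_central (G\<lparr>carrier := H\<rparr>) n \<subseteq> lower_central (G\<lparr>carrier := K\<rparr>) n"
proof (induction n)
  case 0
  then show ?case using assms by simp
next
  case (Suc n)
  show ?case
    unfolding lower_central_Suc_eq[OF assms(1)] lower_central_Suc_eq[OF assms(2)]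
    by (rule mono_generate) (use Suc assms(3) in blast)
qed

lemma finite_rcosets_Int:
  assumes "subgroup H G" "subgroup K G" "finite (rcosets H)" "finite (rcosets K)"
  shows "finite (rcosets (H \<inter> K))"
proof (rule finite_rcosetsI)
  show "subgroup (H \<inter> K) G" by (rule subgroups_Inter_pair[OF assms(1,2)])
  have "(\<lambda>x. (H #> x, K #> x)) ` carrier G \<subseteq> (rcosets H) \<times> (rcosets K)" by (auto simp: RCOSETS_def)
  then show "finite ((\<lambda>x. (H #> x, K #> x)) ` carrier G)" using assms(3,4) finite_subset by blast
next
  fix x y assume "x \<in> carrier G" "y \<in> carrier G" "(H #> x, K #> x) = (H #> y, K #> y)"
  then show "x \<otimes> inv y \<in> H \<inter> K" using rcos_eq_iff[OF assms(1)] rcos_eq_iff[OF assms(2)] by simp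
qed

text \<open>Replacing \<open>H\<close> by \<open>H \<inter> Z\<close> keeps the index finite. One
  further commutator then takes the lower central series from \<open>M\<close> into
  \<open>N\<close>.\<close>

lemma virtually_nilpotent_mod_step:
  assumes "virtually_nilpotent_mod G M" and N: "subgroup N G"
    and Z: "subgroup Z G" "finite (rcosets Z)" and ZM: "\<And>z m. z \<in> Z \<Longrightarrow> m \<in> M \<Longrightarrow> commutator G z m \<in> N"
    and M: "M \<subseteq> carrier G"
  shows "virtually_nilpotent_mod G N"
proof -
  obtain H n where H: "subgroup H G" "finite (rcosets H)" and n: "lower_central (G\<lparr>carrier := H\<rparr>) n \<subseteq> M"
    using assms(1) unfolding virtually_nilpotent_mod_def by blast
  have HZ: "subgroup (H \<inter> Z) G" by (rule subgroups_Inter_pair[OF H(1) Z(1)])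
  have le: "lower_central (G\<lparr>carrier := H \<inter> Z\<rparr>) n \<subseteq> M"
    using lower_central_mono[OF HZ H(1)] n by blast
  have "commutator G x y \<in> N" if "x \<in> lower_central (G\<lparr>carrier := H \<inter> Z\<rparr>) n" "y \<in> H \<inter> Z" for x y
  proof -
    have xM: "x \<in> M" and yZ: "y \<in> Z" using that le by auto
    have "inv (commutator G y x) \<in> N" by (rule subgroup.m_inv_closed[OF N ZM[OF yZ xM]])
    then show ?thesis using xM yZ M subgroup.mem_carrier[OF Z(1)] by (simp add: inv_commutator subset_iff)
  qed
  then have "lower_central (G\<lparr>carrier := H \<inter> Z\<rparr>) (Suc n) \<subseteq> N"
    unfolding lower_central_Suc_eq[OF HZ] by (intro generate_subgroup_incl[OF _ N]) blast
  then show ?thesis unfolding virtually_nilpotent_mod_def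
    using HZ finite_rcosets_Int[OF H(1) Z(1) H(2) Z(2)] by blast
qed

text \<open>The union of an ascending chain is finitely generated and hence equal to a member of the
  chain. The relation is oriented so that an induction may assume the claim for all properly larger
  subgroups.\<close>

lemma wf_noetherian:
  assumes "noetherian_group G"
  shows "wf {(B, A). subgroup A G \<and> subgroup B G \<and> A \<subset> B}"
  unfolding wf_iff_no_infinite_down_chain
proof
  assume "\<exists>f. \<forall>i. (f (Suc i), f i) \<in> {(B, A). subgroup A G \<and> subgroup B G \<and> A \<subset> B}"
  then obtain f where f_all: "\<forall>i. (f (Suc i), f i) \<in> {(B, A). subgroup A G \<and> subgroup B G \<and> A \<subset> B}" by (rule exE)
  have f: "subgroup (f i) G" "f i \<subset> f (Suc i)" for i using f_all by auto
  have mono: "f i \<subseteq> f j" if "i \<le> j" for i j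
    using lift_Suc_mono_le[of f, OF _ that] f(2) by blast
  define U where "U = (\<Union>i. f i)"
  have "subgroup U G"
  proof (rule subgroupI)
    show "U \<subseteq> carrier G" using subgroup.subset[OF f(1)] by (auto simp: U_def)
    show "U \<noteq> {}" using subgroup.one_closed[OF f(1)] by (auto simp: U_def)
  next
    fix a assume "a \<in> U"
    then show "inv a \<in> U" using subgroup.m_inv_closed[OF f(1)] by (auto simp: U_def)
  next
    fix a b assume "a \<in> U" "b \<in> U"
    then obtain i j where "a \<in> f i" "b \<in> f j" by (auto simp: U_def)
    then have "a \<in> f (max i j)" "b \<in> f (max i j)" using mono[of i "max i j"] mono[of j "max i j"] by auto
    then show "a \<otimes> b \<in> U" using subgroup.m_closed[OF f(1)] by (auto simp: U_def)
  qed
  then obtain S where S: "finite S" "S \<subseteq> U" "generate G S = U"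
    using assms unfolding noetherian_group_def by meson
  have "\<exists>n. S \<subseteq> f n" using S(1,2)
  proof (induction S rule: finite_induct)
    case (insert s S)
    then obtain n i where "S \<subseteq> f n" "s \<in> f i" by (auto simp: U_def)
    then have "insert s S \<subseteq> f (max n i)" using mono[of n "max n i"] mono[of i "max n i"] by auto
    then show ?case by blast
  qed simp
  then obtain n where "S \<subseteq> f n" by blast
  then have "U \<subseteq> f n" using generate_subgroup_incl[OF _ f(1)] S(3) by blast
  then show False using f(2)[of n] by (auto simp: U_def)
qed

text \<open>Induction over larger \<open>D\<close>, starting from \<open>D = M\<close>: below
  \<open>M\<close> there is a centralised extension \<open>C\<close> of \<open>D\<close>, the claim
  holds for \<open>C\<close>, and one central step leads from \<open>C\<close> to
  \<open>D\<close>.\<close>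

lemma virtually_nilpotent_mod_descend:
  assumes pc: "polycyclic_seq G (carrier G)"
    and \<H>: "\<And>H. H \<in> \<H> \<Longrightarrow> subgroup H G" "\<not> exp_growth G \<H>"
    and N: "N \<lhd> G" "N = \<Inter>\<H>" and M: "M \<lhd> G" "\<And>x y. x \<in> M \<Longrightarrow> y \<in> M \<Longrightarrow> commutator G x y \<in> N"
    and vM: "virtually_nilpotent_mod G M"
    and D: "D \<lhd> G" "N \<subseteq> D" "D \<subseteq> M"
  shows "virtually_nilpotent_mod G D"
proof -
  have wf: "wf {(B, A). subgroup A G \<and> subgroup B G \<and> A \<subset> B}"
    by (rule wf_noetherian[OF polycyclic_imp_noetherian[OF pc]])
  show ?thesis
    using D
  proof (induction D rule: wf_induct_rule[OF wf])
    case (1 D)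
    show ?case
    proof (cases "D = M")
      case False
      have subD: "subgroup D G" by (rule normal_imp_subgroup[OF 1(2)])
      have sec: "normal_abelian_section G D M"
        by (intro normal_abelian_section.intro abelian_sectionI normal_abelian_section_axioms.intro
            1 M(1) normal_imp_subgroup) (use M(2) 1(3) in blast)
      obtain C where C: "C \<lhd> G" "D \<subset> C" "C \<subseteq> M" "finite (rcosets (centralizer_mod G D C))"
        using normal_abelian_section.ex_centralized_extension[OF sec pc False \<H> N 1(3) M(2)] by blast
      have subC: "subgroup C G" by (rule normal_imp_subgroup[OF C(1)])
      have "virtually_nilpotent_mod G C"
        by (rule 1(1)) (use 1 C subC subD in auto)
      then show ?thesis
        by (rule virtually_nilpotent_mod_step[OF _ subD normal_imp_subgroup[OF centralizer_mod_normal[OF 1(2) C(1)]] C(4)])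
          (auto simp: centralizer_mod_def subgroup.mem_carrier[OF subC])
    qed (use vM in simp)
  qed
qed

end

section \<open>Existence of abelian sections and the passage from \<open>\<H>\<close> to the
  products \<open>HC\<close>\<close>

context group
begin

lemma commutator_eq_one_iff:
  "x \<in> carrier G \<Longrightarrow> y \<in> carrier G \<Longrightarrow> commutator G x y = \<one> \<longleftrightarrow> x \<otimes> y = y \<otimes> x"
proof
  assume c: "x \<in> carrier G" "y \<in> carrier G"
  have eq: "commutator G x y \<otimes> (y \<otimes> x) = x \<otimes> y" using c by (simp add: commutator_def m_assoc)
  show "x \<otimes> y = y \<otimes> x" if "commutator G x y = \<one>" using eq that c by simp
  show "commutator G x y = \<one>" if "x \<otimes> y = y \<otimes> x"
  proof -
    have "commutator G x y = (x \<otimes> y) \<otimes> inv (y \<otimes> x)" using c by (simp add: commutator_def inv_mult_group m_assoc)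
    then show ?thesis using that c by simp
  qed
qed

lemma commutator_mult_central:
  assumes c: "x \<in> carrier G" "y \<in> carrier G" "u \<in> carrier G" "v \<in> carrier G"
    and comm: "u \<otimes> y = y \<otimes> u" "v \<otimes> x = x \<otimes> v" "u \<otimes> v = v \<otimes> u"
  shows "commutator G (x \<otimes> u) (y \<otimes> v) = commutator G x y"
proof -
  have 1: "(x \<otimes> u) \<otimes> (y \<otimes> v) = (x \<otimes> y) \<otimes> (u \<otimes> v)"
  proof -
    have "(x \<otimes> u) \<otimes> (y \<otimes> v) = x \<otimes> (u \<otimes> y) \<otimes> v" using c by (simp add: m_assoc)
    then show ?thesis using c by (simp add: comm(1) m_assoc)
  qed
  have 2: "(y \<otimes> v) \<otimes> (x \<otimes> u) = (y \<otimes> x) \<otimes> (u \<otimes> v)"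
  proof -
    have "(y \<otimes> v) \<otimes> (x \<otimes> u) = y \<otimes> (v \<otimes> x) \<otimes> u" using c by (simp add: m_assoc)
    then show ?thesis using c by (simp add: comm(2,3) m_assoc)
  qed
  have comm_eq: "commutator G a b = (a \<otimes> b) \<otimes> inv (b \<otimes> a)" if "a \<in> carrier G" "b \<in> carrier G" for a b
    using that by (simp add: commutator_def inv_mult_group m_assoc)
  have "commutator G (x \<otimes> u) (y \<otimes> v) = ((x \<otimes> y) \<otimes> (u \<otimes> v)) \<otimes> inv ((y \<otimes> x) \<otimes> (u \<otimes> v))"
    using c comm_eq[of "x \<otimes> u" "y \<otimes> v"] 1 2 by simp
  also have "\<dots> = (x \<otimes> y) \<otimes> ((u \<otimes> v) \<otimes> inv (u \<otimes> v)) \<otimes> inv (y \<otimes> x)"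
    using c by (simp add: inv_mult_group m_assoc del: r_inv)
  also have "\<dots> = (x \<otimes> y) \<otimes> inv (y \<otimes> x)" using c by simp
  finally show ?thesis using c comm_eq by simp
qed

lemma proj_commutator:
  assumes N: "N \<lhd> G" and c: "x \<in> carrier G" "y \<in> carrier G"
  shows "N #> commutator G x y = commutator (G Mod N) (N #> x) (N #> y)"
  using normal.rcos_sum[OF N] normal.inv_FactGroup[OF N] c
  by (simp add: commutator_def normal.rcos_inv[OF N] carrier_FactGroup)

lemma commutator_mem_iff:
  assumes N: "N \<lhd> G" and c: "x \<in> carrier G" "y \<in> carrier G"
  shows "commutator G x y \<in> N \<longleftrightarrow> (N #> x) \<otimes>\<^bsub>G Mod N\<^esub> (N #> y) = (N #> y) \<otimes>\<^bsub>G Mod N\<^esub> (N #> x)"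
proof -
  interpret Q: group "G Mod N" by (rule normal.factorgroup_is_group[OF N])
  have sub: "subgroup N G" by (rule normal_imp_subgroup[OF N])
  have "commutator G x y \<in> N \<longleftrightarrow> N #> commutator G x y = \<one>\<^bsub>G Mod N\<^esub>"
    using coset_join1[OF _ _ sub] coset_join2[OF _ sub] c by auto
  also have "\<dots> \<longleftrightarrow> (N #> x) \<otimes>\<^bsub>G Mod N\<^esub> (N #> y) = (N #> y) \<otimes>\<^bsub>G Mod N\<^esub> (N #> x)"
    unfolding proj_commutator[OF N c] by (rule Q.commutator_eq_one_iff) (use c in \<open>simp_all add: carrier_FactGroup\<close>)
  finally show ?thesis .
qed

text \<open>The coset of \<open>HC\<close> through \<open>t\<close> is the product of the coset of
  \<open>H\<close> through \<open>t\<close> with \<open>C\<close>. Passing to \<open>HC\<close> can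
  thus only merge cosets, and the same \<open>T\<close>, \<open>L\<close> and \<open>d\<close>
  work.\<close>

lemma exp_growth_mult_normal:
  assumes C: "C \<lhd> G" and \<H>: "\<And>H. H \<in> \<H> \<Longrightarrow> subgroup H G"
    and "exp_growth G ((\<lambda>H. H <#> C) ` \<H>)"
  shows "exp_growth G \<H>"
proof -
  obtain T L d where T: "finite T" "T \<subseteq> carrier G"
    and grow: "\<And>n. \<exists>H\<in>(\<lambda>H. H <#> C) ` \<H>. 2 ^ n \<le> card ((\<lambda>t. t <# H) ` ball G T (L * n)) ^ d"
    using assms(3) unfolding exp_growth_def by blast
  have "\<exists>H\<in>\<H>. 2 ^ n \<le> card ((\<lambda>t. t <# H) ` ball G T (L * n)) ^ d" for n
  proof -
    obtain H where H: "H \<in> \<H>" "2 ^ n \<le> card ((\<lambda>t. t <# (H <#> C)) ` ball G T (L * n)) ^ d"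
      using grow[of n] by blast
    let ?B = "ball G T (L * n)"
    have "t <# (H <#> C) = (t <# H) <#> C" if "t \<in> ?B" for t
      using that ball_carrier[OF T(2)] subgroup.subset[OF \<H>[OF H(1)]] subgroup.subset[OF normal_imp_subgroup[OF C]]
      by (intro setmult_lcos_assoc[symmetric]) auto
    then have "(\<lambda>t. t <# (H <#> C)) ` ?B = (\<lambda>X. X <#> C) ` (\<lambda>t. t <# H) ` ?B"
      unfolding image_image by (rule image_cong[OF refl])
    then have "card ((\<lambda>t. t <# (H <#> C)) ` ?B) \<le> card ((\<lambda>t. t <# H) ` ?B)"
      using card_image_le[OF finite_imageI[OF finite_ball[OF T(1)]]] by metis
    then have "card ((\<lambda>t. t <# (H <#> C)) ` ?B) ^ d \<le> card ((\<lambda>t. t <# H) ` ?B) ^ d" by (rule power_mono) simp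
    then show ?thesis using H order_trans by blast
  qed
  then show ?thesis unfolding exp_growth_def using T by blast
qed

text \<open>\<open>M/N\<close> is the last nontrivial term of the derived series of \<open>G/N\<close>.\<close>

lemma ex_normal_abelian_section:
  assumes pc: "polycyclic_seq G (carrier G)" and N: "N \<lhd> G" "N \<noteq> carrier G"
  shows "\<exists>M. normal_abelian_section G N M \<and> N \<noteq> M"
proof -
  have subN: "subgroup N G" by (rule normal_imp_subgroup[OF N(1)])
  have "solvable_seq G H" if "polycyclic_seq G H" for H
    using that
  proof (induction rule: polycyclic_seq.induct)
    case (extension K H)
    then have "comm_group (G\<lparr>carrier := H\<rparr> Mod K)"
      by (intro group.cyclic_imp_abelian_group normal.factorgroup_is_group)
    then show ?case by (rule solvable_seq.extension[OF extension.IH extension.hyps(2,3)])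
  qed (rule solvable_seq.unity)
  then obtain n where n: "(derived G ^^ n) (carrier G) = {\<one>}"
    using solvable_imp_trivial_derived_seq[OF _] pc by meson
  have ex: "\<exists>i. (derived G ^^ i) (carrier G) \<subseteq> N" using n subgroup.one_closed[OF subN] by (intro exI[of _ n]) simp
  define i where "i = (LEAST i. (derived G ^^ i) (carrier G) \<subseteq> N)"
  have i: "(derived G ^^ i) (carrier G) \<subseteq> N" unfolding i_def by (rule LeastI_ex[OF ex])
  have "i \<noteq> 0" using i N(2) subgroup.subset[OF subN] by (cases i) auto
  then obtain j where j: "i = Suc j" by (cases i) auto
  define A where "A = (derived G ^^ j) (carrier G)"
  have A_notin: "\<not> A \<subseteq> N"
  proof
    assume "A \<subseteq> N"
    then have "i \<le> j" unfolding i_def A_def by (rule Least_le)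
    then show False using j by simp
  qed
  have normA: "A \<lhd> G" unfolding A_def by (induction j) (auto simp: normal_self derived_is_normal)
  have subA: "subgroup A G" by (rule normal_imp_subgroup[OF normA])
  note Ac = subgroup.mem_carrier[OF subA]
  have comA: "commutator G a b \<in> N" if "a \<in> A" "b \<in> A" for a b
  proof -
    have "commutator G a b \<in> derived G A"
      unfolding derived_def commutator_def using that by (intro generate.incl) blast
    then show ?thesis using i by (auto simp: j A_def)
  qed
  \<comment> \<open>This is the product of \<open>N\<close> and \<open>A\<close>, written as the
    elements congruent to some element of \<open>A\<close> modulo \<open>N\<close>.\<close>
  define M where "M = {x \<in> carrier G. \<exists>a\<in>A. N #> x = N #> a}"
  have subM: "subgroup M G"
  proof (rule subgroupI)
    show "M \<subseteq> carrier G" by (auto simp: M_def)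
    have "\<one> \<in> M" using subgroup.one_closed[OF subA] by (auto simp: M_def)
    then show "M \<noteq> {}" by blast
  next
    fix x assume "x \<in> M"
    then obtain a where a: "a \<in> A" "x \<in> carrier G" "N #> x = N #> a" by (auto simp: M_def)
    then have "N #> inv x = N #> inv a"
      using normal.rcos_inv[OF N(1), of x] normal.rcos_inv[OF N(1), of a] Ac by simp
    then show "inv x \<in> M" using a subgroup.m_inv_closed[OF subA] by (auto simp: M_def)
  next
    fix x y assume "x \<in> M" "y \<in> M"
    then obtain a b where ab: "a \<in> A" "x \<in> carrier G" "N #> x = N #> a" "b \<in> A" "y \<in> carrier G" "N #> y = N #> b"
      by (auto simp: M_def)
    then have "N #> (x \<otimes> y) = N #> (a \<otimes> b)"
      using normal.rcos_sum[OF N(1), of x y] normal.rcos_sum[OF N(1), of a b] Ac by simp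
    then show "x \<otimes> y \<in> M" using ab subgroup.m_closed[OF subA] by (auto simp: M_def)
  qed
  have normM: "M \<lhd> G"
  proof (rule normalI_conjg[OF subM])
    fix g x assume g: "g \<in> carrier G" and "x \<in> M"
    then obtain a where a: "a \<in> A" "x \<in> carrier G" "N #> x = N #> a" by (auto simp: M_def)
    have "conjg G g x \<otimes> inv (conjg G g a) = conjg G g (x \<otimes> inv a)"
      using g a Ac by (simp add: conjg_mult_right conjg_inv_right)
    moreover have "x \<otimes> inv a \<in> N" using a Ac by (simp add: rcos_eq_iff[OF subN, symmetric])
    ultimately have "N #> conjg G g x = N #> conjg G g a"
      using normal_conjg_closed[OF N(1) g] g a Ac by (simp add: rcos_eq_iff[OF subN])
    then show "conjg G g x \<in> M" using normal_conjg_closed[OF normA g a(1)] g a(2) by (auto simp: M_def)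
  qed
  have NM: "N \<subseteq> M"
  proof
    fix x assume x: "x \<in> N"
    have "N #> x = N #> \<one>" using x subgroup.mem_carrier[OF subN x] by (simp add: rcos_eq_iff[OF subN])
    then show "x \<in> M" using subgroup.one_closed[OF subA] subgroup.mem_carrier[OF subN x] by (auto simp: M_def)
  qed
  have comM: "commutator G x y \<in> N" if xy: "x \<in> M" "y \<in> M" for x y
  proof -
    obtain a b where ab: "a \<in> A" "N #> x = N #> a" "b \<in> A" "N #> y = N #> b"
      using xy by (auto simp: M_def)
    have "commutator G a b \<in> N" by (rule comA[OF ab(1,3)])
    then show ?thesis
      using xy Ac[OF ab(1)] Ac[OF ab(3)] ab(2,4)
      by (simp add: commutator_mem_iff[OF N(1)] M_def)
  qed
  have "A \<subseteq> M" using Ac by (auto simp: M_def)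
  then have "N \<noteq> M" using A_notin by blast
  moreover have "normal_abelian_section G N M"
    by (intro normal_abelian_section.intro abelian_sectionI normal_abelian_section_axioms.intro N subM NM comM normM)
  ultimately show ?thesis by blast
qed

text \<open>The kernel \<open>K\<close> of the action on \<open>X/C\<close> consists of products \<open>h c\<close> with \<open>h\<close> in a given
  point stabiliser; as \<open>C\<close> is central in \<open>Z\<close> modulo \<open>N\<close>, commutators in \<open>K \<inter> Z\<close> agree
  modulo \<open>N\<close> with commutators in every stabiliser, so they fix every point.\<close>

lemma commutator_of_kernel:
  assumes N: "N \<lhd> G" "N = \<Inter>\<H>" and \<H>: "\<And>H. H \<in> \<H> \<Longrightarrow> subgroup H G"
    and C: "C \<lhd> G" "C \<subseteq> centralizer_mod G N C"
    and k: "k \<in> \<Inter>((\<lambda>H. H <#> C) ` \<H>) \<inter> centralizer_mod G N C"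
    and k': "k' \<in> \<Inter>((\<lambda>H. H <#> C) ` \<H>) \<inter> centralizer_mod G N C"
  shows "commutator G k k' \<in> N"
proof -
  define Z where "Z = centralizer_mod G N C"
  have subZ: "subgroup Z G" unfolding Z_def by (rule normal_imp_subgroup[OF centralizer_mod_normal[OF N(1) C(1)]])
  have subC: "subgroup C G" by (rule normal_imp_subgroup[OF C(1)])
  have subN: "subgroup N G" by (rule normal_imp_subgroup[OF N(1)])
  note Zc = subgroup.mem_carrier[OF subZ]
  interpret Q: group "G Mod N" by (rule normal.factorgroup_is_group[OF N(1)])
  have central: "(N #> c) \<otimes>\<^bsub>G Mod N\<^esub> (N #> z) = (N #> z) \<otimes>\<^bsub>G Mod N\<^esub> (N #> c)" if c: "c \<in> C" and z: "z \<in> Z" for c z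
  proof -
    have "commutator G z c \<in> N" using c z by (simp add: Z_def centralizer_mod_def)
    then show ?thesis
      unfolding commutator_mem_iff[OF N(1) Zc[OF z] subgroup.mem_carrier[OF subC c]] by (rule sym)
  qed
  have "commutator G k k' \<in> H" if H: "H \<in> \<H>" for H
  proof -
    obtain h c where h: "h \<in> H" "c \<in> C" "k = h \<otimes> c" using k H unfolding set_mult_def by blast
    obtain h' c' where h': "h' \<in> H" "c' \<in> C" "k' = h' \<otimes> c'" using k' H unfolding set_mult_def by blast
    have cZ: "c \<in> Z" "c' \<in> Z" using h(2) h'(2) C(2) by (auto simp: Z_def)
    have Hc: "h \<in> carrier G" "h' \<in> carrier G" using h(1) h'(1) subgroup.mem_carrier[OF \<H>[OF H]] by auto
    have "h = k \<otimes> inv c" using h Hc Zc[OF cZ(1)] by (simp add: m_assoc)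
    then have hZ: "h \<in> Z" using k subgroup.m_closed[OF subZ _ subgroup.m_inv_closed[OF subZ cZ(1)]] by (simp add: Z_def)
    have "h' = k' \<otimes> inv c'" using h' Hc Zc[OF cZ(2)] by (simp add: m_assoc)
    then have hZ': "h' \<in> Z" using k' subgroup.m_closed[OF subZ _ subgroup.m_inv_closed[OF subZ cZ(2)]] by (simp add: Z_def)
    let ?p = "\<lambda>x. N #> x"
    have pc: "?p x \<in> carrier (G Mod N)" if "x \<in> Z" for x using Zc[OF that] by (simp add: carrier_FactGroup)
    have pm: "?p (x \<otimes> y) = ?p x \<otimes>\<^bsub>G Mod N\<^esub> ?p y" if "x \<in> Z" "y \<in> Z" for x y
      using normal.rcos_sum[OF N(1) Zc[OF that(1)] Zc[OF that(2)]] by simp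
    have kc: "k \<in> carrier G" "k' \<in> carrier G" using h h' Hc Zc cZ by auto
    have "?p (commutator G k k') = commutator (G Mod N) (?p h \<otimes>\<^bsub>G Mod N\<^esub> ?p c) (?p h' \<otimes>\<^bsub>G Mod N\<^esub> ?p c')"
      unfolding proj_commutator[OF N(1) kc] using h(3) h'(3) pm hZ hZ' cZ by simp
    also have "\<dots> = commutator (G Mod N) (?p h) (?p h')"
      by (rule Q.commutator_mult_central[OF pc[OF hZ] pc[OF hZ'] pc[OF cZ(1)] pc[OF cZ(2)]
            central[OF h(2) hZ'] central[OF h'(2) hZ] central[OF h(2) cZ(2)]])
    also have "\<dots> = ?p (commutator G h h')" by (rule proj_commutator[OF N(1) Hc, symmetric])
    finally have "commutator G k k' \<otimes> inv (commutator G h h') \<in> N"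
      using kc Hc by (simp add: rcos_eq_iff[OF subN])
    then have 1: "commutator G k k' \<otimes> inv (commutator G h h') \<in> H" using N(2) H by blast
    have 2: "commutator G h h' \<in> H"
      unfolding commutator_def
      by (intro subgroup.m_closed[OF \<H>[OF H]] subgroup.m_inv_closed[OF \<H>[OF H]] h(1) h'(1))
    have "commutator G k k' \<otimes> inv (commutator G h h') \<otimes> commutator G h h' \<in> H"
      by (rule subgroup.m_closed[OF \<H>[OF H] 1 2])
    then show ?thesis using kc Hc by (simp add: m_assoc)
  qed
  then show ?thesis using N(2) by blast
qed

lemma Inter_conjg_closed_normal:
  assumes \<H>: "\<H> \<noteq> {}" "\<And>H. H \<in> \<H> \<Longrightarrow> subgroup H G"
    and conj: "\<And>H g. H \<in> \<H> \<Longrightarrow> g \<in> carrier G \<Longrightarrow> conjg G g ` H \<in> \<H>"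
  shows "\<Inter>\<H> \<lhd> G"
proof (rule normalI_conjg)
  show "subgroup (\<Inter>\<H>) G" by (rule subgroups_Inter[OF \<H>(2,1)])
next
  fix g x assume g: "g \<in> carrier G" and x: "x \<in> \<Inter>\<H>"
  have "conjg G g x \<in> H" if H: "H \<in> \<H>" for H
  proof -
    have "x \<in> conjg G (inv g) ` H" using x conj[OF H, of "inv g"] g by blast
    then obtain h where h: "h \<in> H" "x = conjg G (inv g) h" by blast
    then show ?thesis using g subgroup.mem_carrier[OF \<H>(2)[OF H]] by simp
  qed
  then show "conjg G g x \<in> \<Inter>\<H>" by blast
qed

theorem virtually_nilpotent_mod_Inter:
  assumes pc: "polycyclic_seq G (carrier G)"
    and \<H>: "\<H> \<noteq> {}" "\<And>H. H \<in> \<H> \<Longrightarrow> subgroup H G"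
      "\<And>H g. H \<in> \<H> \<Longrightarrow> g \<in> carrier G \<Longrightarrow> conjg G g ` H \<in> \<H>" "\<not> exp_growth G \<H>"
  shows "virtually_nilpotent_mod G (\<Inter>\<H>)"
proof -
  have wf: "wf {(B, A). subgroup A G \<and> subgroup B G \<and> A \<subset> B}"
    by (rule wf_noetherian[OF polycyclic_imp_noetherian[OF pc]])
  \<comment> \<open>The family must be universally quantified within the induction, because the step
    passes from \<open>\<H>\<close> to the different family \<open>\<K>\<close>.\<close>
  have "\<forall>\<H>. N = \<Inter>\<H> \<and> \<H> \<noteq> {} \<and> (\<forall>H\<in>\<H>. subgroup H G) \<and> (\<forall>H\<in>\<H>. \<forall>g\<in>carrier G. conjg G g ` H \<in> \<H>) \<and> \<not> exp_growth G \<H>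
      \<longrightarrow> virtually_nilpotent_mod G N" for N
  proof (induction N rule: wf_induct_rule[OF wf])
    case (1 N)
    show ?case
    proof (intro allI impI, elim conjE)
      fix \<H> assume N: "N = \<Inter>\<H>" and ne: "\<H> \<noteq> {}" and "\<forall>H\<in>\<H>. subgroup H G"
        and "\<forall>H\<in>\<H>. \<forall>g\<in>carrier G. conjg G g ` H \<in> \<H>" and not_exp: "\<not> exp_growth G \<H>"
      then have sub: "\<And>H. H \<in> \<H> \<Longrightarrow> subgroup H G"
        and conj: "\<And>H g. H \<in> \<H> \<Longrightarrow> g \<in> carrier G \<Longrightarrow> conjg G g ` H \<in> \<H>" by auto
      have normN: "N \<lhd> G" unfolding N by (rule Inter_conjg_closed_normal[OF ne sub conj])
      have subN: "subgroup N G" by (rule normal_imp_subgroup[OF normN])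
      show "virtually_nilpotent_mod G N"
      proof (cases "N = carrier G")
        case True
        have "finite (rcosets (carrier G))"
          by (rule finite_rcosetsI[OF subgroup_self, of "\<lambda>_. ()"]) auto
        moreover have "lower_central (G\<lparr>carrier := carrier G\<rparr>) 0 \<subseteq> N" using True by simp
        ultimately show ?thesis unfolding virtually_nilpotent_mod_def using subgroup_self by blast
      next
        case False
        obtain M where M: "normal_abelian_section G N M" "N \<noteq> M"
          using ex_normal_abelian_section[OF pc normN False] by blast
        interpret M: normal_abelian_section G N M by (rule M(1))
        obtain C where C: "C \<lhd> G" "N \<subset> C" "C \<subseteq> M" "finite (rcosets (centralizer_mod G N C))"
          using M.ex_centralized_extension[OF pc M(2) sub not_exp normN N subset_refl M.comm_in_N] by blast
        have subC: "subgroup C G" by (rule normal_imp_subgroup[OF C(1)])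
        note Cc = subgroup.mem_carrier[OF subC]
        define Z where "Z = centralizer_mod G N C"
        have normZ: "Z \<lhd> G" unfolding Z_def by (rule centralizer_mod_normal[OF normN C(1)])
        have subZ: "subgroup Z G" by (rule normal_imp_subgroup[OF normZ])
        have CZ: "C \<subseteq> Z" using C(3) M.comm_in_N Cc by (simp add: Z_def centralizer_mod_def subset_iff)
        define \<K> where "\<K> = (\<lambda>H. H <#> C) ` \<H>"
        define K where "K = \<Inter>\<K>"
        have sub_HC: "subgroup (H <#> C) G" if "H \<in> \<H>" for H
          using mult_norm_subgroup[OF C(1) sub[OF that]] commut_normal[OF sub[OF that] C(1)] by simp
        have conj_HC: "conjg G g ` (H <#> C) = conjg G g ` H <#> C" if H: "H \<in> \<H>" and g: "g \<in> carrier G" for H g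
        proof
          show "conjg G g ` (H <#> C) \<subseteq> conjg G g ` H <#> C"
          proof
            fix x assume "x \<in> conjg G g ` (H <#> C)"
            then obtain h c where hc: "h \<in> H" "c \<in> C" "x = conjg G g (h \<otimes> c)" unfolding set_mult_def by blast
            then have "x = conjg G g h \<otimes> conjg G g c"
              using g Cc subgroup.mem_carrier[OF sub[OF H]] by (simp add: conjg_mult_right)
            then show "x \<in> conjg G g ` H <#> C"
              using hc(1) normal_conjg_closed[OF C(1) g hc(2)] unfolding set_mult_def by blast
          qed
          show "conjg G g ` H <#> C \<subseteq> conjg G g ` (H <#> C)"
          proof
            fix x assume "x \<in> conjg G g ` H <#> C"
            then obtain h c where hc: "h \<in> H" "c \<in> C" "x = conjg G g h \<otimes> c" unfolding set_mult_def by blast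
            then have "x = conjg G g (h \<otimes> conjg G (inv g) c)"
              using g Cc subgroup.mem_carrier[OF sub[OF H]] by (simp add: conjg_mult_right)
            moreover have "h \<otimes> conjg G (inv g) c \<in> H <#> C"
              using hc(1) normal_conjg_closed[OF C(1) inv_closed[OF g] hc(2)] unfolding set_mult_def by blast
            ultimately show "x \<in> conjg G g ` (H <#> C)" by blast
          qed
        qed
        have \<K>: "\<K> \<noteq> {}" "\<And>H. H \<in> \<K> \<Longrightarrow> subgroup H G"
          "\<And>H g. H \<in> \<K> \<Longrightarrow> g \<in> carrier G \<Longrightarrow> conjg G g ` H \<in> \<K>"
          using ne sub_HC conj conj_HC by (auto simp: \<K>_def)
        have not_exp_K: "\<not> exp_growth G \<K>"
          using exp_growth_mult_normal[OF C(1) sub] not_exp unfolding \<K>_def by blast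
        have normK: "K \<lhd> G" unfolding K_def by (rule Inter_conjg_closed_normal[OF \<K>])
        have subK: "subgroup K G" by (rule normal_imp_subgroup[OF normK])
        have "C \<subseteq> H <#> C" if H: "H \<in> \<H>" for H
        proof
          fix c assume c: "c \<in> C"
          have "\<one> \<otimes> c \<in> H <#> C" using subgroup.one_closed[OF sub[OF H]] c unfolding set_mult_def by blast
          then show "c \<in> H <#> C" using Cc[OF c] by simp
        qed
        then have CK: "C \<subseteq> K" by (auto simp: K_def \<K>_def)
        then have "(K, N) \<in> {(B, A). subgroup A G \<and> subgroup B G \<and> A \<subset> B}" using C(2) subK subN by auto
        from 1[OF this] have vK: "virtually_nilpotent_mod G K"
          using \<K> not_exp_K K_def by blast
        have normKZ: "K \<inter> Z \<lhd> G" by (rule normal_subgroup_intersect[OF normK normZ])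
        \<comment> \<open>\<open>K\<close> itself need not be abelian modulo \<open>N\<close>.
          \<open>Z\<close> has finite index, and commutators of \<open>Z\<close> with
          \<open>K\<close> lie in both normal subgroups, so intersecting with \<open>Z\<close> costs
          only one central step.\<close>
        have vKZ: "virtually_nilpotent_mod G (K \<inter> Z)"
        proof (rule virtually_nilpotent_mod_step[OF vK normal_imp_subgroup[OF normKZ] subZ])
          show "finite (rcosets Z)" unfolding Z_def by (rule C(4))
          show "K \<subseteq> carrier G" by (rule subgroup.subset[OF subK])
          fix z m assume z: "z \<in> Z" and m: "m \<in> K"
          have zc: "z \<in> carrier G" and mc: "m \<in> carrier G"
            using subgroup.mem_carrier[OF subZ z] subgroup.mem_carrier[OF subK m] .
          have "commutator G z m = conjg G z m \<otimes> inv m" using zc mc by (rule commutator_conv_conjg)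
          then have "commutator G z m \<in> K"
            using subgroup.m_closed[OF subK normal_conjg_closed[OF normK zc m] subgroup.m_inv_closed[OF subK m]] by simp
          moreover have "commutator G z m = z \<otimes> conjg G m (inv z)" using zc mc by (simp add: commutator_def conjg_def m_assoc)
          then have "commutator G z m \<in> Z"
            using subgroup.m_closed[OF subZ z normal_conjg_closed[OF normZ mc subgroup.m_inv_closed[OF subZ z]]] by simp
          ultimately show "commutator G z m \<in> K \<inter> Z" by blast
        qed
        have comKZ: "commutator G x y \<in> N" if "x \<in> K \<inter> Z" "y \<in> K \<inter> Z" for x y
          using commutator_of_kernel[OF normN N sub C(1) CZ[unfolded Z_def]] that
          unfolding K_def \<K>_def Z_def by blast
        show ?thesis
        proof (rule virtually_nilpotent_mod_descend[OF pc sub not_exp normN N normKZ comKZ vKZ normN subset_refl])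
          show "N \<subseteq> K \<inter> Z" using C(2) CK CZ by blast
        qed
      qed
    qed
  qed
  then show ?thesis using \<H> by blast
qed


end

section \<open>Word length and stabilisers\<close>

context group
begin

lemma word_append:
  "set us \<subseteq> carrier G \<Longrightarrow> set vs \<subseteq> carrier G \<Longrightarrow>
    foldr (\<otimes>) (us @ vs) \<one> \<in> carrier G \<and> foldr (\<otimes>) (us @ vs) \<one> = foldr (\<otimes>) us \<one> \<otimes> foldr (\<otimes>) vs \<one>"
proof (induction us)
  case Nil
  have "foldr (\<otimes>) vs \<one> \<in> carrier G" using Nil(2) by (induction vs) auto
  then show ?case by simp
next
  case (Cons u us)
  have "foldr (\<otimes>) us \<one> \<in> carrier G" "foldr (\<otimes>) vs \<one> \<in> carrier G"
    using Cons.prems by (induction us, auto) (induction vs, auto)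
  then show ?case using Cons by (simp add: m_assoc)
qed

lemma generate_word:
  assumes S: "S \<subseteq> carrier G" "\<And>s. s \<in> S \<Longrightarrow> inv s \<in> S" and "g \<in> generate G S"
  shows "\<exists>ws. set ws \<subseteq> S \<and> foldr (\<otimes>) ws \<one> = g"
  using assms(3)
proof (induction rule: generate.induct)
  case one
  then show ?case by (intro exI[of _ "[]"]) simp
next
  case (incl h)
  then show ?case using S by (intro exI[of _ "[h]"]) auto
next
  case (inv h)
  then show ?case using S by (intro exI[of _ "[inv h]"]) auto
next
  case (eng h1 h2)
  then obtain us vs where uv: "set us \<subseteq> S" "foldr (\<otimes>) us \<one> = h1" "set vs \<subseteq> S" "foldr (\<otimes>) vs \<one> = h2" by auto
  have "foldr (\<otimes>) (us @ vs) \<one> = h1 \<otimes> h2"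
    using word_append[of us vs] uv S(1) by (simp del: foldr_append add: subset_trans[OF _ S(1)])
  then show ?case using uv by (intro exI[of _ "us @ vs"]) simp
qed

lemma word_length_le:
  assumes "set ws \<subseteq> S" "foldr (\<otimes>) ws \<one> = g"
  shows "word_length G S g \<le> length ws"
  unfolding word_length_def by (rule Least_le) (use assms in auto)

lemma word_length_word:
  assumes S: "S \<subseteq> carrier G" "\<And>s. s \<in> S \<Longrightarrow> inv s \<in> S" "g \<in> generate G S"
  shows "\<exists>ws. set ws \<subseteq> S \<and> length ws = word_length G S g \<and> foldr (\<otimes>) ws \<one> = g"
proof -
  obtain ws where "set ws \<subseteq> S" "foldr (\<otimes>) ws \<one> = g" using generate_word[OF S] by blast
  then have "\<exists>us. set us \<subseteq> S \<and> length us = length ws \<and> foldr (\<otimes>) us \<one> = g" by blast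
  then show ?thesis unfolding word_length_def by (rule LeastI)
qed

lemma finite_word_ball:
  assumes S: "finite S" "symmetric_generating_set G S"
  shows "finite {g \<in> carrier G. word_length G S g \<le> n}"
proof (rule finite_subset)
  show "{g \<in> carrier G. word_length G S g \<le> n} \<subseteq> (\<lambda>ws. foldr (\<otimes>) ws \<one>) ` {ws. set ws \<subseteq> S \<and> length ws \<le> n}"
  proof
    fix g assume g: "g \<in> {g \<in> carrier G. word_length G S g \<le> n}"
    then obtain ws where "set ws \<subseteq> S" "length ws = word_length G S g" "foldr (\<otimes>) ws \<one> = g"
      using word_length_word[of S g] S(2) unfolding symmetric_generating_set_def by auto
    then show "g \<in> (\<lambda>ws. foldr (\<otimes>) ws \<one>) ` {ws. set ws \<subseteq> S \<and> length ws \<le> n}" using g by auto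
  qed
  show "finite ((\<lambda>ws. foldr (\<otimes>) ws \<one>) ` {ws. set ws \<subseteq> S \<and> length ws \<le> n})"
    by (intro finite_imageI finite_lists_length_le S(1))
qed

text \<open>Each letter of \<open>T\<close> is rewritten as a word in \<open>S\<close>; the sum of
  the lengths of these words bounds every one of them.\<close>

lemma word_length_ball:
  assumes S: "symmetric_generating_set G S" and T: "finite T" "T \<subseteq> carrier G"
  shows "\<exists>L. \<forall>m. \<forall>g\<in>ball G T m. word_length G S g \<le> L * m"
proof -
  have Sc: "S \<subseteq> carrier G" "\<And>s. s \<in> S \<Longrightarrow> inv s \<in> S" "generate G S = carrier G"
    using S by (auto simp: symmetric_generating_set_def)
  have "\<exists>ws. set ws \<subseteq> S \<and> foldr (\<otimes>) ws \<one> = t" if "t \<in> T" for t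
    by (rule generate_word[OF Sc(1,2)]) (use that T Sc(3) in auto)
  then obtain W where W: "\<And>t. t \<in> T \<Longrightarrow> set (W t) \<subseteq> S \<and> foldr (\<otimes>) (W t) \<one> = t" by metis
  define L where "L = (\<Sum>t\<in>T. length (W t))"
  have "\<exists>ws. set ws \<subseteq> S \<and> length ws \<le> L * m \<and> foldr (\<otimes>) ws \<one> = g" if "g \<in> ball G T m" for g m
    using that
  proof (induction m arbitrary: g)
    case 0
    then show ?case by (intro exI[of _ "[]"]) simp
  next
    case (Suc m)
    then obtain t u where tu: "t \<in> T" "u \<in> ball G T m" "g = t \<otimes> u" by auto
    obtain us where us: "set us \<subseteq> S" "length us \<le> L * m" "foldr (\<otimes>) us \<one> = u" using Suc.IH[OF tu(2)] by blast
    have "length (W t) \<le> L" unfolding L_def by (rule member_le_sum) (use T tu in auto)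
    moreover have "foldr (\<otimes>) (W t @ us) \<one> = g"
      using word_append[of "W t" us] W[OF tu(1)] us tu(3) subset_trans[OF _ Sc(1)] by (simp del: foldr_append)
    ultimately show ?case using W[OF tu(1)] us by (intro exI[of _ "W t @ us"]) auto
  qed
  then have "word_length G S g \<le> L * m" if "g \<in> ball G T m" for g m
    using that word_length_le[of _ S g] by fastforce
  then show ?thesis by blast
qed

lemma virtually_nilpotent_mod_one:
  assumes "virtually_nilpotent_mod G {\<one>}"
  shows "virtually_nilpotent G"
proof -
  obtain H n where H: "subgroup H G" "finite (rcosets H)" "lower_central (G\<lparr>carrier := H\<rparr>) n \<subseteq> {\<one>}"
    using assms unfolding virtually_nilpotent_mod_def by blast
  have "\<one> \<in> lower_central (G\<lparr>carrier := H\<rparr>) n"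
  proof (cases n)
    case 0
    then show ?thesis using subgroup.one_closed[OF H(1)] by simp
  next
    case (Suc m)
    then show ?thesis unfolding Suc lower_central_Suc_eq[OF H(1)] by (simp add: generate.one)
  qed
  then have "lower_central (G\<lparr>carrier := H\<rparr>) n = {\<one>\<^bsub>G\<lparr>carrier := H\<rparr>\<^esub>}" using H(3) by auto
  then have "nilpotent_group (G\<lparr>carrier := H\<rparr>)"
    unfolding nilpotent_group_def using subgroup_imp_group[OF H(1)] by blast
  then show ?thesis unfolding virtually_nilpotent_def using H(1,2) by blast
qed

end

section \<open>Stabilisers, orbits and the kernel of an action\<close>

context group_action
begin

lemma conjg_stabilizer:
  assumes x: "x \<in> E" and g: "g \<in> carrier G"
  shows "conjg G g ` stabilizer G \<phi> x = stabilizer G \<phi> (\<phi> g x)"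
proof -
  interpret group G using group_hom by (rule group_hom.axioms(1))
  have *: "conjg G g h \<in> stabilizer G \<phi> (\<phi> g x)" if x: "x \<in> E" and g: "g \<in> carrier G" and "h \<in> stabilizer G \<phi> x" for g h x
  proof -
    have h: "h \<in> carrier G" "\<phi> h x = x" using that(3) by (auto simp: stabilizer_def)
    have gx: "\<phi> g x \<in> E" using element_image[OF g x] by blast
    have "\<phi> (conjg G g h) (\<phi> g x) = \<phi> g (\<phi> h (\<phi> (inv g) (\<phi> g x)))"
      using g h(1) gx element_image[OF inv_closed[OF g] gx refl] unfolding conjg_def
      by (simp add: composition_rule)
    also have "\<phi> (inv g) (\<phi> g x) = x" by (rule orbit_sym_aux[OF g x refl])
    finally show ?thesis using h g by (simp add: stabilizer_def)
  qed
  show ?thesis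
  proof
    show "conjg G g ` stabilizer G \<phi> x \<subseteq> stabilizer G \<phi> (\<phi> g x)" using *[OF x g] by blast
    show "stabilizer G \<phi> (\<phi> g x) \<subseteq> conjg G g ` stabilizer G \<phi> x"
    proof
      fix y assume y: "y \<in> stabilizer G \<phi> (\<phi> g x)"
      have "conjg G (inv g) y \<in> stabilizer G \<phi> (\<phi> (inv g) (\<phi> g x))"
        by (rule *[OF element_image[OF g x refl] inv_closed[OF g] y])
      moreover have "\<phi> (inv g) (\<phi> g x) = x" by (rule orbit_sym_aux[OF g x refl])
      moreover have "y = conjg G g (conjg G (inv g) y)" using y g by (simp add: stabilizer_def)
      ultimately show "y \<in> conjg G g ` stabilizer G \<phi> x" by auto
    qed
  qed
qed

text \<open>The coset of the stabiliser through \<open>t\<close> is the fibre of the orbit map over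
  \<open>\<phi> t x\<close>, so it depends only on that point.\<close>

lemma card_cosets_stabilizer_le:
  assumes x: "x \<in> E" and B: "finite B" "B \<subseteq> carrier G"
  shows "card ((\<lambda>t. t <#\<^bsub>G\<^esub> stabilizer G \<phi> x) ` B) \<le> card ((\<lambda>t. \<phi> t x) ` B)"
proof -
  interpret group G using group_hom by (rule group_hom.axioms(1))
  have "t <# stabilizer G \<phi> x = {g \<in> carrier G. \<phi> g x = \<phi> t x}" if t: "t \<in> carrier G" for t
  proof
    show "t <# stabilizer G \<phi> x \<subseteq> {g \<in> carrier G. \<phi> g x = \<phi> t x}"
      using t x by (auto simp: l_coset_def stabilizer_def composition_rule)
    show "{g \<in> carrier G. \<phi> g x = \<phi> t x} \<subseteq> t <# stabilizer G \<phi> x"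
    proof clarify
      fix g assume g: "g \<in> carrier G" "\<phi> g x = \<phi> t x"
      have "\<phi> (inv t \<otimes> g) x = \<phi> (inv t) (\<phi> t x)" using g t x by (simp add: composition_rule)
      also have "\<dots> = x" by (rule orbit_sym_aux[OF t x refl])
      finally have "inv t \<otimes> g \<in> stabilizer G \<phi> x" using g t by (simp add: stabilizer_def)
      moreover have "g = t \<otimes> (inv t \<otimes> g)" using g t by simp
      ultimately show "g \<in> t <# stabilizer G \<phi> x" unfolding l_coset_def by blast
    qed
  qed
  then have "(\<lambda>t. t <# stabilizer G \<phi> x) ` B = (\<lambda>v. {g \<in> carrier G. \<phi> g x = v}) ` (\<lambda>t. \<phi> t x) ` B"
    unfolding image_image using B(2) by (intro image_cong refl) blast
  then show ?thesis by (simp add: card_image_le B(1))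
qed

end

lemma (in faithful_action) Inter_stabilizers:
  assumes "E \<noteq> {}"
  shows "\<Inter>(stabilizer G \<phi> ` E) = {\<one>}"
proof
  interpret group G using group_hom by (rule group_hom.axioms(1))
  show "\<Inter>(stabilizer G \<phi> ` E) \<subseteq> {\<one>}"
  proof
    fix g assume g: "g \<in> \<Inter>(stabilizer G \<phi> ` E)"
    then have gc: "g \<in> carrier G" and fix_all: "\<And>x. x \<in> E \<Longrightarrow> \<phi> g x = x" using assms by (auto simp: stabilizer_def)
    have "\<phi> g = \<phi> \<one>"
    \<comment> \<open>The maps \<open>\<phi> g\<close> belong to \<open>Bij E\<close>, whose members
      are extensional; agreement on \<open>E\<close> is therefore equality, and injectivity of
      \<open>\<phi>\<close> applies.\<close>
    proof (rule extensionalityI[of _ E])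
      show "\<phi> g \<in> extensional E" "\<phi> \<one> \<in> extensional E"
        using bij_prop0[OF gc] bij_prop0[OF one_closed] by (auto simp: Bij_def)
      show "\<phi> g x = \<phi> \<one> x" if "x \<in> E" for x
        using fix_all[OF that] that by (simp flip: id_eq_one)
    qed
    then show "g \<in> {\<one>}" using inj_onD[OF faithful _ gc one_closed] by simp
  qed
  show "{\<one>} \<subseteq> \<Inter>(stabilizer G \<phi> ` E)"
    by (auto simp: stabilizer_def simp flip: id_eq_one)
qed

lemma card_orbit_le_action_growth:
  assumes "group G" and S: "finite S" "symmetric_generating_set G S" and x: "x \<in> X"
  shows "card {\<phi> g x | g. g \<in> carrier G \<and> word_length G S g \<le> n} \<le> action_growth G S X \<phi> n"
  unfolding action_growth_def
proof (rule Max_ge)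
  interpret group G by fact
  let ?B = "{g \<in> carrier G. word_length G S g \<le> n}"
  have eq: "{\<phi> g x | g. g \<in> carrier G \<and> word_length G S g \<le> n} = (\<lambda>g. \<phi> g x) ` ?B" for x by blast
  have "(\<lambda>x. card {\<phi> g x | g. g \<in> carrier G \<and> word_length G S g \<le> n}) ` X \<subseteq> {..card ?B}"
    unfolding eq using card_image_le[OF finite_word_ball[OF S]] by blast
  then show "finite ((\<lambda>x. card {\<phi> g x | g. g \<in> carrier G \<and> word_length G S g \<le> n}) ` X)"
    using finite_subset by blast
qed (use x in blast)

text \<open>Base 4 is chosen as a power of 2 above e, so that it can be read off from the powers of
  2 in \<open>exp_growth\<close>.\<close>

lemma exp_le_4_power: "exp (real n) \<le> 4 ^ n"
proof -
  have "exp (real n) = exp 1 ^ n" by (simp add: exp_of_nat_mult[symmetric])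
  also have "\<dots> \<le> 4 ^ n" using exp_le by (intro power_mono) auto
  finally show ?thesis .
qed

theorem corollary3p9:
  fixes G :: "('a, 'm) monoid_scheme"
  assumes "polycyclic_group G"
    and "\<not> virtually_nilpotent G"
  shows "has_schreier_growth_gap TYPE('x) G (\<lambda>n. exp (real n))"
  unfolding has_schreier_growth_gap_def
proof (intro allI impI, elim conjE)
  fix S and X :: "'x set" and \<phi>
  assume S: "finite S" "symmetric_generating_set G S" and X: "X \<noteq> {}" and "faithful_action G X \<phi>"
  interpret faithful_action G X \<phi> by fact
  have grp: "group G" and pc: "polycyclic_seq G (carrier G)" using assms(1) by (auto simp: polycyclic_group_def)
  interpret group G by (rule grp)
  let ?\<H> = "stabilizer G \<phi> ` X"
  have "exp_growth G ?\<H>"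
  proof (rule ccontr)
    assume not_exp: "\<not> exp_growth G ?\<H>"
    have "virtually_nilpotent_mod G (\<Inter>?\<H>)"
    proof (rule virtually_nilpotent_mod_Inter[OF pc _ _ _ not_exp])
      show "?\<H> \<noteq> {}" using X by simp
      show "subgroup H G" if "H \<in> ?\<H>" for H using that stabilizer_subgroup by blast
      show "conjg G g ` H \<in> ?\<H>" if "H \<in> ?\<H>" and g: "g \<in> carrier G" for H g
      proof -
        obtain x where x: "x \<in> X" "H = stabilizer G \<phi> x" using \<open>H \<in> ?\<H>\<close> by blast
        then show ?thesis using conjg_stabilizer[OF x(1) g] element_image[OF g x(1) refl] by simp
      qed
    qed
    then show False
      using virtually_nilpotent_mod_one assms(2) unfolding Inter_stabilizers[OF X] by blast
  qed
  then obtain T L d where T: "finite T" "T \<subseteq> carrier G"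
    and grow: "\<And>n. \<exists>H\<in>?\<H>. 2 ^ n \<le> card ((\<lambda>t. t <#\<^bsub>G\<^esub> H) ` ball G T (L * n)) ^ d"
    unfolding exp_growth_def by blast
  \<comment> \<open>For \<open>d = 0\<close> the bound at 1 would read
    \<open>2 \<le> 1\<close>.\<close>
  have d: "d > 0" using grow[of 1] by (cases d) auto
  obtain L' where L': "\<And>m g. g \<in> ball G T m \<Longrightarrow> word_length G S g \<le> L' * m"
    using word_length_ball[OF S(2) T] by blast
  \<comment> \<open>The growth bound is used at \<open>2 * n * d\<close>, where extracting the
    \<open>d\<close>-th root of \<open>2 ^ (2 * n * d)\<close> leaves \<open>4 ^ n\<close>.
    \<open>L\<close> turns this index into a radius over \<open>T\<close>, and \<open>L'\<close>
    turns that radius into word length over \<open>S\<close>. The summand 1 makes \<open>C\<close>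
    positive and gives the final factor \<open>real C\<close> at no cost.\<close>
  define C where "C = L' * L * (2 * d) + 1"
  have "exp (real n) \<le> real C * real (action_growth G S X \<phi> (C * n))" for n
  proof -
    let ?V = "action_growth G S X \<phi> (C * n)"
    let ?B = "ball G T (L * (2 * n * d))"
    obtain x where x: "x \<in> X"
      and large: "2 ^ (2 * n * d) \<le> card ((\<lambda>t. t <#\<^bsub>G\<^esub> stabilizer G \<phi> x) ` ?B) ^ d"
      using grow[of "2 * n * d"] by blast
    note large
    also have "card ((\<lambda>t. t <#\<^bsub>G\<^esub> stabilizer G \<phi> x) ` ?B) ^ d \<le> ?V ^ d"
    proof (rule power_mono)
      have "card ((\<lambda>t. t <#\<^bsub>G\<^esub> stabilizer G \<phi> x) ` ?B) \<le> card ((\<lambda>t. \<phi> t x) ` ?B)"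
        by (rule card_cosets_stabilizer_le[OF x finite_ball[OF T(1)] ball_carrier[OF T(2)]])
      also have "\<dots> \<le> card {\<phi> g x | g. g \<in> carrier G \<and> word_length G S g \<le> C * n}"
      proof (rule card_mono)
        have "{\<phi> g x | g. g \<in> carrier G \<and> word_length G S g \<le> C * n}
            = (\<lambda>g. \<phi> g x) ` {g \<in> carrier G. word_length G S g \<le> C * n}" by blast
        then show "finite {\<phi> g x | g. g \<in> carrier G \<and> word_length G S g \<le> C * n}"
          using finite_word_ball[OF S] by simp
        have "word_length G S g \<le> C * n" if "g \<in> ?B" for g
        proof -
          have "word_length G S g \<le> L' * (L * (2 * n * d))" by (rule L'[OF that])
          also have "\<dots> \<le> C * n" by (simp add: C_def algebra_simps)
          finally show ?thesis .
        qed
        then show "(\<lambda>t. \<phi> t x) ` ?B \<subseteq> {\<phi> g x | g. g \<in> carrier G \<and> word_length G S g \<le> C * n}"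
          using ball_carrier[OF T(2)] by blast
      qed
      also have "\<dots> \<le> ?V" by (rule card_orbit_le_action_growth[OF grp S x])
      finally show "card ((\<lambda>t. t <#\<^bsub>G\<^esub> stabilizer G \<phi> x) ` ?B) \<le> ?V" .
    qed simp
    finally have "(4 ^ n) ^ d \<le> ?V ^ d" by (simp add: power_mult)
    then have "4 ^ n \<le> ?V" using d by simp
    then have "(4::real) ^ n \<le> real ?V" by (metis of_nat_le_iff of_nat_numeral of_nat_power)
    then have "exp (real n) \<le> real ?V" using exp_le_4_power[of n] by linarith
    also have "\<dots> \<le> real C * real ?V" by (simp add: C_def algebra_simps)
    finally show ?thesis .
  qed
  then show "(\<lambda>n. exp (real n)) \<preccurlyeq> (\<lambda>n. real (action_growth G S X \<phi> n))"
    unfolding growth_dominated_def by (intro exI[of _ C]) (simp add: C_def)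
qed



end
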